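(* Assume that $\mathcal A$ is compact; that for each $\xi\in\Xi$, $\mathcal C(s,a,\xi)$ and $g(s,a,\xi)$ are continuous in $(s,a)$; and that there are constants $\bar{\mathcal C}_w>0$, $\kappa_w\ge0$ such that $|\mathcal C(s,a,\xi)|\le\bar{\mathcal C}_ww(s)$ and $w(g(s,a,\xi))\le\kappa_ww(s)$ for all $(s,a,\xi)\in\mathcal S\times\mathcal A\times\Xi$, with $\gamma\kappa_w<1$. Assume that $\mathcal C(s,a,\xi)$ and $g(s,a,\xi)$ are Lipschitz continuous in $s\in\mathcal S$ uniformly for all $(a,\xi)\in\mathcal A\times\Xi$, with Lipschitz constants $L_{\mathcal C}$ and $L_g$ respectively, and $\gamma L_g<1$. Assume further that there exist constants $L_1,L_2>0$ such that for any $s\in\mathcal S$ and all $\xi,\xi'\in\Xi$, $$\sup_{a\in\mathcal A}|\mathcal C(s,a,\xi)-\mathcal C(s,a,\xi')|\le L_1\|\xi-\xi'\|,\qquad \sup_{a\in\mathcal A}\|g(s,a,\xi)-g(s,a,\xi')\|\le L_2\|\xi-\xi'\|.$$ Then there exists a constant $L>0$, independent of $N$ and $s$, such that for all $s\in\mathcal S$ (and all $N\in\mathbb N$), $$\mathsf d_K\left((P^c)^{\otimes N}\circ(\bar T_N^s)^{-1},(\tilde P^c)^{\otimes N}\circ(\bar T_N^s)^{-1}\right)\le L\,\mathsf d_K(P^c,\tilde P^c).$$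
   Context: $\mathcal S\subseteq\mathbb R^m$ and $\mathcal A\subseteq\mathbb R^n$ are nonempty closed sets; $\Xi=\{\xi^1,\dots,\xi^J\}\subseteq\mathbb R^k$ is a finite set of $J$ distinct points; $\mathscr P(\Xi)$ is the set of probability measures on $\Xi$, identified with the probability vectors $\{P=(p_j)_{j=1}^J\in[0,1]^J:\sum_{j=1}^Jp_j=1\}$ via $p_j=P(\xi=\xi^j)$. $\mathcal C:\mathcal S\times\mathcal A\times\Xi\to\mathbb R$ is the cost, $g:\mathcal S\times\mathcal A\times\Xi\to\mathcal S$ the transition function, $\gamma\in[0,1)$ the discount factor. $P^c\in\mathscr P(\Xi)$ is the true distribution and $\tilde P^c\in\mathscr P(\Xi)$ a perturbed distribution. $\|\cdot\|$ is the Euclidean norm. Ambiguity set: prior parameters $\tau_{j,0}>1$, $\alpha\in(0,1)$, $\alpha'=\alpha/J$ are fixed and $z_{1-\alpha'/2}$ is the $(1-\alpha'/2)$-quantile of the standard normal distribution. For $(\xi_1,\dots,\xi_N)\in\Xi^N$ define $$\hat p_{j,N}=\frac{\tau_{j,0}-1+\sum_{i=1}^N\mathbf 1_{\{\xi_i=\xi^j\}}}{\sum_{k=1}^J\tau_{k,0}-J+N},\qquad \hat r_{j,N}=z_{1-\alpha'/2}\sqrt{\frac{\hat p_{j,N}(1-\hat p_{j,N})}{\sum_{k=1}^J\tau_{k,0}-J+N}},$$ $\hat P_N=(\hat p_{j,N})_j$, $\hat r_N=(\hat r_{j,N})_j$, and $\mathfrak P(P,r)=\{Q\in\mathscr P(\Xi):p_j-r_j\le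 q_j\le p_j+r_j,\ j=1,\dots,J\}$. Weighted norm: $w:\mathcal S\to[1,\infty)$ is a fixed continuous function, $\|V\|_w=\sup_{s\in\mathcal S}|V(s)|/w(s)$, $\mathscr V(\mathcal S)=\{V:\mathcal S\to\mathbb R:\|V\|_w<\infty\}$. $\hat V_N^*$ (depending on $(\xi_1,\dots,\xi_N)$) is the unique fixed point in $\mathscr V(\mathcal S)$ of $$\hat{\mathcal L}_N(V)(s)=\inf_{a\in\mathcal A}\sup_{P\in\mathfrak P(\hat P_N,\hat r_N)}\mathbb E_P[\mathcal C(s,a,\xi)+\gamma V(g(s,a,\xi))].$$ For $s\in\mathcal S$, $\bar T_N^s:\Xi^N\to\mathbb R$ is the map $\bar T_N^s(\xi_1,\dots,\xi_N)=\hat V_N^*(s)/w(s)$. $P^{\otimes N}$ is the $N$-fold product measure of $P$ on $\Xi^N$, and $P^{\otimes N}\circ(\bar T_N^s)^{-1}$ is the law of $\bar T_N^s$ under it. $\mathsf d_K$ is the Kantorovich metric $\mathsf d_K(P,Q)=\sup_h|\mathbb E_P[h]-\mathbb E_Q[h]|$ over all 1-Lipschitz functions $h$ (on $\mathrm{conv}\,\Xi$ for measures on $\Xi$; on $\mathbb R$ for the laws of $\bar T_N^s$). *)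

theory Defs
  imports "HOL-Probability.Probability"
begin

definition prob_measures :: "'a set \<Rightarrow> 'a measure set" where
  "prob_measures X = {P. prob_space P \<and> sets P = Pow X}"

text \<open>The supremum is taken in the extended reals, so that it is never a junk value. For measures
  on the finite set \<open>\<Xi>\<close> the parameter \<open>X\<close> is the convex hull of \<open>\<Xi>\<close>, for laws on the line it is
  the whole line.\<close>

definition kantorovich :: "'a::metric_space set \<Rightarrow> 'a measure \<Rightarrow> 'a measure \<Rightarrow> ereal" where
  "kantorovich X P Q =
     (SUP h\<in>{h :: 'a \<Rightarrow> real. 1-lipschitz_on X h}. ereal \<bar>(\<integral>x. h x \<partial>P) - (\<integral>x. h x \<partial>Q)\<bar>)"

definition quantile :: "real measure \<Rightarrow> real \<Rightarrow> real" where
  "quantile M u = Inf {x. u \<le> cdf M x}"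

text \<open>The support points are \<open>\<xi> 1, \<dots>, \<xi> J\<close>, the sample is \<open>\<omega> 1, \<dots>, \<omega> N\<close>, and \<open>\<tau>\<close> holds the
  prior parameters.\<close>

definition posterior_total :: "(nat \<Rightarrow> real) \<Rightarrow> nat \<Rightarrow> nat \<Rightarrow> real" where
  "posterior_total \<tau> J N = (\<Sum>k=1..J. \<tau> k) - real J + real N"

definition p_hat ::
  "(nat \<Rightarrow> real) \<Rightarrow> nat \<Rightarrow> (nat \<Rightarrow> 'a) \<Rightarrow> nat \<Rightarrow> (nat \<Rightarrow> 'a) \<Rightarrow> nat \<Rightarrow> real" where
  "p_hat \<tau> J \<xi> N \<omega> j =
     (\<tau> j - 1 + (\<Sum>i=1..N. indicator {\<xi> j} (\<omega> i))) / posterior_total \<tau> J N"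

definition r_hat ::
  "real \<Rightarrow> (nat \<Rightarrow> real) \<Rightarrow> nat \<Rightarrow> (nat \<Rightarrow> 'a) \<Rightarrow> nat \<Rightarrow> (nat \<Rightarrow> 'a) \<Rightarrow> nat \<Rightarrow> real" where
  "r_hat \<alpha> \<tau> J \<xi> N \<omega> j =
     quantile std_normal_distribution (1 - (\<alpha> / real J) / 2) *
     sqrt (p_hat \<tau> J \<xi> N \<omega> j * (1 - p_hat \<tau> J \<xi> N \<omega> j) / posterior_total \<tau> J N)"

definition ambiguity_set ::
  "nat \<Rightarrow> (nat \<Rightarrow> 'a) \<Rightarrow> (nat \<Rightarrow> real) \<Rightarrow> (nat \<Rightarrow> real) \<Rightarrow> 'a measure set" where
  "ambiguity_set J \<xi> p r =
     {Q \<in> prob_measures (\<xi> ` {1..J}).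
        \<forall>j\<in>{1..J}. p j - r j \<le> measure Q {\<xi> j} \<and> measure Q {\<xi> j} \<le> p j + r j}"

definition wnorm :: "'s set \<Rightarrow> ('s \<Rightarrow> real) \<Rightarrow> ('s \<Rightarrow> real) \<Rightarrow> ereal" where
  "wnorm S w V = (SUP s\<in>S. ereal (\<bar>V s\<bar> / w s))"

text \<open>Functions on \<open>S\<close> are represented by their extensional versions, which makes a fixed point on
  \<open>S\<close> unique as a HOL function.\<close>

definition wspace :: "'s set \<Rightarrow> ('s \<Rightarrow> real) \<Rightarrow> ('s \<Rightarrow> real) set" where
  "wspace S w = {V \<in> extensional S. wnorm S w V < \<infinity>}"

text \<open>The infimum and supremum are real-valued. They are genuine as long as \<open>A\<close> and \<open>\<PP>\<close> are
  nonempty and the one-step costs at \<open>s\<close> are bounded, which the weighted growth conditions ensure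
  for every \<open>V\<close> in the weighted space.\<close>

definition robust_bellman ::
  "'s set \<Rightarrow> 'a set \<Rightarrow> ('s \<Rightarrow> 'a \<Rightarrow> 'x \<Rightarrow> real) \<Rightarrow> ('s \<Rightarrow> 'a \<Rightarrow> 'x \<Rightarrow> 's) \<Rightarrow> real \<Rightarrow>
   'x measure set \<Rightarrow> ('s \<Rightarrow> real) \<Rightarrow> 's \<Rightarrow> real" where
  "robust_bellman S A C g \<gamma> \<PP> V =
     (\<lambda>s\<in>S. INF a\<in>A. SUP P\<in>\<PP>. \<integral>x. (C s a x + \<gamma> * V (g s a x)) \<partial>P)"

definition V_hat ::
  "'s set \<Rightarrow> 'a set \<Rightarrow> ('s \<Rightarrow> 'a \<Rightarrow> 'x \<Rightarrow> real) \<Rightarrow> ('s \<Rightarrow> 'a \<Rightarrow> 'x \<Rightarrow> 's) \<Rightarrow> real \<Rightarrow> ('s \<Rightarrow> real) \<Rightarrow>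
   real \<Rightarrow> (nat \<Rightarrow> real) \<Rightarrow> nat \<Rightarrow> (nat \<Rightarrow> 'x) \<Rightarrow> nat \<Rightarrow> (nat \<Rightarrow> 'x) \<Rightarrow> 's \<Rightarrow> real" where
  "V_hat S A C g \<gamma> w \<alpha> \<tau> J \<xi> N \<omega> =
     (THE V. V \<in> wspace S w \<and>
        robust_bellman S A C g \<gamma>
          (ambiguity_set J \<xi> (p_hat \<tau> J \<xi> N \<omega>) (r_hat \<alpha> \<tau> J \<xi> N \<omega>)) V = V)"

definition T_bar ::
  "'s set \<Rightarrow> 'a set \<Rightarrow> ('s \<Rightarrow> 'a \<Rightarrow> 'x \<Rightarrow> real) \<Rightarrow> ('s \<Rightarrow> 'a \<Rightarrow> 'x \<Rightarrow> 's) \<Rightarrow> real \<Rightarrow> ('s \<Rightarrow> real) \<Rightarrow>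
   real \<Rightarrow> (nat \<Rightarrow> real) \<Rightarrow> nat \<Rightarrow> (nat \<Rightarrow> 'x) \<Rightarrow> nat \<Rightarrow> 's \<Rightarrow> (nat \<Rightarrow> 'x) \<Rightarrow> real" where
  "T_bar S A C g \<gamma> w \<alpha> \<tau> J \<xi> N s \<omega> = V_hat S A C g \<gamma> w \<alpha> \<tau> J \<xi> N \<omega> s / w s"

text \<open>For \<open>P \<in> prob_measures \<Xi>\<close> with \<open>\<Xi>\<close> finite, every subset of \<open>\<Xi>\<^sup>N\<close> is measurable for the product
  measure, so every \<open>T\<close> is a random variable and \<open>distr\<close> yields its law.\<close>

definition sample_law :: "nat \<Rightarrow> 'x measure \<Rightarrow> ((nat \<Rightarrow> 'x) \<Rightarrow> real) \<Rightarrow> real measure" where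
  "sample_law N P T = distr (\<Pi>\<^sub>M i\<in>{1..N}. P) borel T"

end

theory Submission
  imports Defs
begin

text \<open>Changing one observation moves \<open>p_hat\<close> by at most \<open>1/n\<close>, where \<open>n\<close> is the posterior total,
  and moves \<open>r_hat\<close> by \<open>O(1/n)\<close>, because the prior keeps the variances
  \<open>p_hat * (1 - p_hat)\<close> above a multiple of \<open>1/n\<close>. The ambiguity set depends on its parameters in a
  Lipschitz way in the \<open>l\<^sup>1\<close> distance, and the Bellman operator contracts the weighted norm, so
  the weighted value moves by \<open>O(1/n)\<close> as well, uniformly in the state. As \<open>\<Xi>\<close> is finite, distinct
  observations lie at least some \<open>\<delta> > 0\<close> apart, which makes this a Lipschitz bound of order
  \<open>1/(n \<delta>)\<close> in each observation. Exchanging the two product measures coordinate by coordinate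
  adds up \<open>N < n\<close> such contributions.\<close>

section \<open>Measures on finite sets and the Kantorovich metric\<close>

text \<open>Order \<open>1/n\<close> per observation is what a constant free of \<open>N\<close>
  tolerates: \<open>N\<close> exchanges are added up, so a slower decay would leave a factor growing
  with \<open>N\<close>. In \<open>r_hat\<close> the powers match as follows: the radicand
  \<open>p_hat * (1 - p_hat) / n\<close> moves by order \<open>1/n^2\<close>, while its root is at
  least of order \<open>1/n\<close>; the quotient is of order \<open>1/n\<close>. The value map sees
  an observation only through the indicators of the points \<open>\<xi> j\<close>, which carry no
  metric information. Its oscillation is therefore bounded first, and the separation
  \<open>\<delta>\<close> brings in the distance afterwards. The resulting constant is
  \<open>K / \<delta>\<close> with \<open>K = C_w / (1 - \<gamma> * \<kappa>_w)^2 * (2 * (J * (1 +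
  R)))\<close>. One factor \<open>1 / (1 - \<gamma> * \<kappa>_w)\<close> bounds the fixed points,
  the other converts a one-step discrepancy of two operators into a distance of their fixed points.
  \<open>J * (1 + R)\<close> collects the changes of the \<open>J\<close> centres and radii, and the
  2 is the price of restoring total mass one. All errors are measured relative to \<open>w\<close>,
  so the division by \<open>w s\<close> in \<open>T_bar\<close> removes the state.\<close>

lemma prob_measuresD:
  assumes "P \<in> prob_measures X"
  shows "prob_space P" "sets P = Pow X" "space P = X"
  using assms sets_eq_imp_space_eq[of P "count_space X"] by (auto simp: prob_measures_def)

lemma measurable_prob_measures:
  assumes "P \<in> prob_measures X"
  shows "f \<in> borel_measurable P"
  using prob_measuresD[OF assms] by (auto simp: measurable_def)

lemma integrable_prob_measures:
  fixes f :: "'a \<Rightarrow> real"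
  assumes "P \<in> prob_measures X" "finite X"
  shows "integrable P f"
proof -
  interpret prob_space P using assms(1) by (rule prob_measuresD)
  show ?thesis
    using assms prob_measuresD[OF assms(1)]
    by (intro integrable_const_bound[where B = "\<Sum>x\<in>X. \<bar>f x\<bar>"])
       (auto intro!: AE_I2 member_le_sum measurable_prob_measures)
qed

lemma integral_prob_measures:
  fixes f :: "'a \<Rightarrow> real"
  assumes P: "P \<in> prob_measures X" and X: "finite X"
  shows "integral\<^sup>L P f = (\<Sum>x\<in>X. f x * measure P {x})"
proof -
  note D = prob_measuresD[OF P]
  have "integral\<^sup>L P f = (\<integral>y. (\<Sum>x\<in>X. f x * indicator {x} y) \<partial>P)"
    using D X by (intro Bochner_Integration.integral_cong refl)
       (auto simp: indicator_def sum.delta)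
  also have "\<dots> = (\<Sum>x\<in>X. \<integral>y. f x * indicator {x} y \<partial>P)"
    by (rule Bochner_Integration.integral_sum) (rule integrable_prob_measures[OF P X])
  also have "\<dots> = (\<Sum>x\<in>X. f x * measure P {x})"
    using D by (intro sum.cong) (auto simp: Int_absorb1)
  finally show ?thesis .
qed

lemma sum_measure_prob_measures:
  assumes P: "P \<in> prob_measures X" and X: "finite X"
  shows "(\<Sum>x\<in>X. measure P {x}) = 1"
proof -
  interpret prob_space P using P by (rule prob_measuresD)
  show ?thesis using integral_prob_measures[OF P X, of "\<lambda>_. 1"] by (simp add: prob_space)
qed

lemma integral_prob_measures_abs_le:
  assumes P: "P \<in> prob_measures X" and X: "finite X"
    and f: "\<And>x. x \<in> X \<Longrightarrow> \<bar>f x :: real\<bar> \<le> B"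
  shows "\<bar>\<integral>x. f x \<partial>P\<bar> \<le> B"
proof -
  have "\<bar>\<integral>x. f x \<partial>P\<bar> \<le> (\<Sum>x\<in>X. B * measure P {x})"
    unfolding integral_prob_measures[OF P X]
    by (intro order_trans[OF sum_abs sum_mono]) (auto simp: abs_mult intro: mult_right_mono f)
  then show ?thesis
    by (simp add: sum_distrib_left[symmetric] sum_measure_prob_measures[OF P X])
qed

text \<open>The product sigma-algebra on a finite power of a finite set is discrete. Hence every
  function of a sample is measurable and integrable, the value map included.\<close>

lemma PiM_prob_measures:
  assumes P: "P \<in> prob_measures X" and "finite X" "finite I"
  shows "PiM I (\<lambda>_. P) \<in> prob_measures (I \<rightarrow>\<^sub>E X)"
proof -
  have "sets (PiM I (\<lambda>_. P)) = sets (PiM I (\<lambda>_. count_space X))"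
    using prob_measuresD[OF P] by (intro sets_PiM_cong) auto
  also have "\<dots> = Pow (I \<rightarrow>\<^sub>E X)"
    using assms by (simp add: count_space_PiM_finite countable_finite)
  finally show ?thesis
    using prob_measuresD(1)[OF P] by (auto simp: prob_measures_def intro: prob_space_PiM)
qed

text \<open>The measure is exchanged one coordinate at a time, at a cost of at most \<open>D\<close> per coordinate.\<close>

lemma product_integral_diff_le:
  fixes \<phi> :: "('i \<Rightarrow> 'a) \<Rightarrow> real"
  assumes P: "P \<in> prob_measures X" and Q: "Q \<in> prob_measures X" and X: "finite X"
    and I: "finite I"
    and D: "\<And>\<eta> i. \<eta> \<in> I \<rightarrow>\<^sub>E X \<Longrightarrow> i \<in> I \<Longrightarrow>
      \<bar>(\<integral>x. \<phi> (\<eta>(i := x)) \<partial>P) - (\<integral>x. \<phi> (\<eta>(i := x)) \<partial>Q)\<bar> \<le> D"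
  shows "\<bar>(\<integral>\<eta>. \<phi> \<eta> \<partial>PiM I (\<lambda>_. P)) - (\<integral>\<eta>. \<phi> \<eta> \<partial>PiM I (\<lambda>_. Q))\<bar> \<le> real (card I) * D"
  using I D
proof (induction I arbitrary: \<phi>)
  case empty
  then show ?case by (simp add: PiM_empty)
next
  case (insert i I)
  interpret P: product_prob_space "\<lambda>_. P"
    using prob_measuresD(1)[OF P] by (simp add: product_prob_spaceI)
  interpret Q: product_prob_space "\<lambda>_. Q"
    using prob_measuresD(1)[OF Q] by (simp add: product_prob_spaceI)
  interpret PI: prob_space "PiM I (\<lambda>_. P)" using prob_measuresD(1)[OF P] by (rule prob_space_PiM)
  note PM = PiM_prob_measures[OF _ X]
  \<comment> \<open>\<open>\<psi>\<close> has coordinate \<open>i\<close> already averaged under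
    \<open>Q\<close> and serves as the intermediate term: estimate \<open>1\<close> exchanges
    coordinate \<open>i\<close> while the others stay under \<open>P\<close>, estimate
    \<open>2\<close> exchanges the others by induction.\<close>
  define \<psi> where "\<psi> \<eta> = (\<integral>x. \<phi> (\<eta>(i := x)) \<partial>Q)" for \<eta>
  have eP: "(\<integral>\<eta>. \<phi> \<eta> \<partial>PiM (insert i I) (\<lambda>_. P)) = (\<integral>\<eta>. (\<integral>x. \<phi> (\<eta>(i := x)) \<partial>P) \<partial>PiM I (\<lambda>_. P))"
    using insert.hyps X
    by (intro P.product_integral_insert integrable_prob_measures[OF PM[OF P]] finite_PiE) auto
  have eQ: "(\<integral>\<eta>. \<phi> \<eta> \<partial>PiM (insert i I) (\<lambda>_. Q)) = (\<integral>\<eta>. \<psi> \<eta> \<partial>PiM I (\<lambda>_. Q))"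
    unfolding \<psi>_def using insert.hyps X
    by (intro Q.product_integral_insert integrable_prob_measures[OF PM[OF Q]] finite_PiE) auto
  have int: "integrable (PiM I (\<lambda>_. P)) f" for f :: "('i \<Rightarrow> 'a) \<Rightarrow> real"
    using insert.hyps X by (intro integrable_prob_measures[OF PM[OF P]] finite_PiE) auto
  have "\<bar>(\<integral>\<eta>. (\<integral>x. \<phi> (\<eta>(i := x)) \<partial>P) \<partial>PiM I (\<lambda>_. P)) - (\<integral>\<eta>. \<psi> \<eta> \<partial>PiM I (\<lambda>_. P))\<bar>
      \<le> (\<integral>\<eta>. \<bar>(\<integral>x. \<phi> (\<eta>(i := x)) \<partial>P) - \<psi> \<eta>\<bar> \<partial>PiM I (\<lambda>_. P))"
    by (subst Bochner_Integration.integral_diff[symmetric, OF int int]) (rule integral_abs_bound)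
  also have "\<dots> \<le> (\<integral>\<eta>. D \<partial>PiM I (\<lambda>_. P))"
  proof (rule integral_mono[OF int int])
    fix \<eta> assume "\<eta> \<in> space (PiM I (\<lambda>_. P))"
    then have w: "\<eta> \<in> I \<rightarrow>\<^sub>E X" using prob_measuresD(3)[OF P] by (simp add: space_PiM)
    \<comment> \<open>The hypothesis on \<open>D\<close> concerns points with a value at every index
      of \<open>insert i I\<close>; \<open>x0\<close> fills slot \<open>i\<close> and is overwritten
      at once.\<close>
    obtain x0 where x0: "x0 \<in> X"
      using sum_measure_prob_measures[OF P X] by (cases "X = {}") auto
    have "\<eta>(i := x0) \<in> insert i I \<rightarrow>\<^sub>E X" using w x0 by (auto simp: PiE_def extensional_def)
    then have "\<bar>(\<integral>x. \<phi> (\<eta>(i := x0, i := x)) \<partial>P) - (\<integral>x. \<phi> (\<eta>(i := x0, i := x)) \<partial>Q)\<bar> \<le> D"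
      by (rule insert.prems) simp
    then show "\<bar>(\<integral>x. \<phi> (\<eta>(i := x)) \<partial>P) - \<psi> \<eta>\<bar> \<le> D"
      by (simp only: \<psi>_def fun_upd_upd)
  qed
  also have "\<dots> = D" by (simp add: PI.prob_space)
  finally have 1: "\<bar>(\<integral>\<eta>. (\<integral>x. \<phi> (\<eta>(i := x)) \<partial>P) \<partial>PiM I (\<lambda>_. P)) - (\<integral>\<eta>. \<psi> \<eta> \<partial>PiM I (\<lambda>_. P))\<bar> \<le> D" .
  have 2: "\<bar>(\<integral>\<eta>. \<psi> \<eta> \<partial>PiM I (\<lambda>_. P)) - (\<integral>\<eta>. \<psi> \<eta> \<partial>PiM I (\<lambda>_. Q))\<bar> \<le> real (card I) * D"
  proof (rule insert.IH)
    fix \<eta> k assume w: "\<eta> \<in> I \<rightarrow>\<^sub>E X" and k: "k \<in> I"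
    then have ki: "k \<noteq> i" using insert.hyps by auto
    let ?d = "\<lambda>x. (\<integral>y. \<phi> (\<eta>(i := x, k := y)) \<partial>P) - (\<integral>y. \<phi> (\<eta>(i := x, k := y)) \<partial>Q)"
    \<comment> \<open>\<open>\<psi>\<close> inherits the bound \<open>D\<close> as a
      \<open>Q\<close>-average of functions that satisfy it; the two finite sums are interchanged to
      show this.\<close>
    have swap: "(\<integral>y. \<psi> (\<eta>(k := y)) \<partial>R) = (\<Sum>x\<in>X. (\<integral>y. \<phi> (\<eta>(i := x, k := y)) \<partial>R) * measure Q {x})"
      if R: "R \<in> prob_measures X" for R
      unfolding \<psi>_def integral_prob_measures[OF Q X] integral_prob_measures[OF R X]
        sum_distrib_right fun_upd_twist[OF ki]
      by (subst sum.swap) (simp add: mult.assoc mult.commute mult.left_commute)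
    have "(\<integral>y. \<psi> (\<eta>(k := y)) \<partial>P) - (\<integral>y. \<psi> (\<eta>(k := y)) \<partial>Q) = (\<Sum>x\<in>X. ?d x * measure Q {x})"
      unfolding swap[OF P] swap[OF Q] by (simp add: sum_subtractf left_diff_distrib)
    also have "\<bar>\<dots>\<bar> \<le> (\<Sum>x\<in>X. D * measure Q {x})"
    proof (rule order_trans[OF sum_abs sum_mono])
      fix x assume "x \<in> X"
      then have "\<eta>(i := x) \<in> insert i I \<rightarrow>\<^sub>E X" using w by (auto simp: PiE_def extensional_def)
      then have "\<bar>?d x\<bar> \<le> D" by (rule insert.prems) (use k in simp)
      then show "\<bar>?d x * measure Q {x}\<bar> \<le> D * measure Q {x}"
        by (simp add: abs_mult mult_right_mono)
    qed
    also have "\<dots> = D"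
      by (simp add: sum_distrib_left[symmetric] sum_measure_prob_measures[OF Q X])
    finally show "\<bar>(\<integral>y. \<psi> (\<eta>(k := y)) \<partial>P) - (\<integral>y. \<psi> (\<eta>(k := y)) \<partial>Q)\<bar> \<le> D" .
  qed
  have "real (card (insert i I)) * D = D + real (card I) * D"
    using insert.hyps by (simp add: algebra_simps)
  then show ?case unfolding eP eQ using 1 2 by linarith
qed

text \<open>McShane's extension, with a minimum in place of the infimum because \<open>X\<close> is
  finite.\<close>

lemma lipschitz_extension_finite:
  fixes f :: "'a::metric_space \<Rightarrow> real"
  assumes X: "finite X" "X \<noteq> {}" and f: "L-lipschitz_on X f"
  obtains h where "L-lipschitz_on UNIV h" "\<And>x. x \<in> X \<Longrightarrow> h x = f x"
proof
  let ?h = "\<lambda>y. Min ((\<lambda>x. f x + L * dist x y) ` X)"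
  have L: "0 \<le> L" using f by (rule lipschitz_on_nonneg)
  have le: "?h y \<le> ?h z + L * dist y z" for y z
  proof -
    have "?h z \<in> (\<lambda>x. f x + L * dist x z) ` X" using X by (intro Min_in) auto
    then obtain x where x: "x \<in> X" "?h z = f x + L * dist x z" by auto
    have "?h y \<le> f x + L * dist x y" using X x by (intro Min_le) auto
    also have "\<dots> \<le> f x + L * (dist x z + dist y z)"
      using L dist_triangle2[of x y z] by (intro add_left_mono mult_left_mono)
    finally show ?thesis unfolding x(2) by (simp add: algebra_simps)
  qed
  show "L-lipschitz_on UNIV ?h"
  proof (rule lipschitz_onI[OF _ L])
    fix y z show "dist (?h y) (?h z) \<le> L * dist y z"
      using le[of y z] le[of z y] by (simp add: dist_real_def dist_commute abs_le_iff)
  qed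
  fix x assume x: "x \<in> X"
  show "?h x = f x"
  proof (rule antisym)
    show "?h x \<le> f x" using X x by (intro Min_le) (auto intro!: image_eqI[of _ _ x])
    have "f x \<le> f y + L * dist y x" if "y \<in> X" for y
      using lipschitz_onD[OF f x that] by (simp add: dist_real_def dist_commute)
    then show "f x \<le> ?h x" using X by simp
  qed
qed

lemma kantorovich_ge:
  "1-lipschitz_on X h \<Longrightarrow> ereal \<bar>(\<integral>x. h x \<partial>P) - (\<integral>x. h x \<partial>Q)\<bar> \<le> kantorovich X P Q"
  unfolding kantorovich_def by (rule SUP_upper) simp

lemma kantorovich_nonneg: "0 \<le> kantorovich X P Q"
  using kantorovich_ge[of X "\<lambda>_. 0" P Q] by (simp add: lipschitz_on_def zero_ereal_def)

text \<open>Extended from the finite support to the whole space and divided by \<open>c\<close>,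
  \<open>f\<close> becomes an admissible test function for every \<open>Y\<close>, in particular for
  the convex hull.\<close>

lemma integral_diff_le_kantorovich:
  fixes f :: "'a::metric_space \<Rightarrow> real"
  assumes P: "P \<in> prob_measures X" and Q: "Q \<in> prob_measures X" and X: "finite X"
    and c: "0 < c" and f: "c-lipschitz_on X f"
  shows "ereal \<bar>(\<integral>x. f x \<partial>P) - (\<integral>x. f x \<partial>Q)\<bar> \<le> ereal c * kantorovich Y P Q"
proof -
  have "X \<noteq> {}" using sum_measure_prob_measures[OF P X] by auto
  then obtain h where h: "c-lipschitz_on UNIV h" "\<And>x. x \<in> X \<Longrightarrow> h x = f x"
    using lipschitz_extension_finite[OF X _ f] by metis
  have "1-lipschitz_on Y (\<lambda>x. h x / c)"
  proof (rule lipschitz_onI)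
    fix x y
    have "\<bar>h x - h y\<bar> \<le> c * dist x y"
      using lipschitz_onD[OF h(1), of x y] by (simp add: dist_real_def)
    then show "dist (h x / c) (h y / c) \<le> 1 * dist x y"
      using c by (simp add: dist_real_def diff_divide_distrib[symmetric] abs_divide field_simps)
  qed simp
  then have "ereal \<bar>(\<integral>x. h x / c \<partial>P) - (\<integral>x. h x / c \<partial>Q)\<bar> \<le> kantorovich Y P Q"
    by (rule kantorovich_ge)
  then have "ereal c * ereal \<bar>(\<integral>x. h x / c \<partial>P) - (\<integral>x. h x / c \<partial>Q)\<bar> \<le> ereal c * kantorovich Y P Q"
    using c by (intro ereal_mult_left_mono) auto
  moreover have "(\<integral>x. h x \<partial>R) = (\<integral>x. f x \<partial>R)" if "R \<in> prob_measures X" for R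
    using h(2) prob_measuresD(3)[OF that] by (intro Bochner_Integration.integral_cong) auto
  moreover have "c * \<bar>u / c - v / c\<bar> = \<bar>u - v\<bar>" for u v
    using c by (simp add: diff_divide_distrib[symmetric])
  ultimately show ?thesis using P Q by simp
qed

text \<open>Composing \<open>T\<close> with a 1-Lipschitz test function keeps the constant
  \<open>c\<close> in each coordinate, so each exchanged coordinate costs \<open>c\<close> times the
  distance of \<open>P\<close> and \<open>Q\<close>.\<close>

lemma kantorovich_sample_law_le:
  fixes T :: "(nat \<Rightarrow> 'a::metric_space) \<Rightarrow> real"
  assumes P: "P \<in> prob_measures X" and Q: "Q \<in> prob_measures X" and X: "finite X"
    and c: "0 < c"
    and T: "\<And>\<eta> i x y. \<eta> \<in> {1..N} \<rightarrow>\<^sub>E X \<Longrightarrow> i \<in> {1..N} \<Longrightarrow> x \<in> X \<Longrightarrow> y \<in> X \<Longrightarrow>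
      \<bar>T (\<eta>(i := x)) - T (\<eta>(i := y))\<bar> \<le> c * dist x y"
  shows "kantorovich UNIV (sample_law N P T) (sample_law N Q T)
    \<le> ereal (real N * c) * kantorovich Y P Q"
proof (cases "N = 0")
  case True
  then have "sample_law N P T = sample_law N Q T" by (simp add: sample_law_def PiM_empty)
  then show ?thesis using True
    by (auto simp: kantorovich_def zero_ereal_def[symmetric] intro!: SUP_least)
next
  case N: False
  show ?thesis
  proof (cases "kantorovich Y P Q")
    \<comment> \<open>\<open>Y\<close> is arbitrary, so an infinite value has to be allowed. The
      right side is then infinite as well, because \<open>N\<close> is positive here.\<close>
    case PInf
    then show ?thesis using N c by simp
  next
    case MInf
    then show ?thesis using kantorovich_nonneg[of Y P Q] by simp
  next
    case (real d)
    have "\<bar>(\<integral>x. h x \<partial>sample_law N P T) - (\<integral>x. h x \<partial>sample_law N Q T)\<bar> \<le> real N * c * d"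
      if h: "1-lipschitz_on UNIV h" for h
    proof -
      have hb: "h \<in> borel_measurable borel"
        using lipschitz_on_continuous_on[OF h] by (rule borel_measurable_continuous_onI)
      have law: "(\<integral>x. h x \<partial>sample_law N R T) = (\<integral>\<eta>. h (T \<eta>) \<partial>PiM {1..N} (\<lambda>_. R))"
        if "R \<in> prob_measures X" for R
        unfolding sample_law_def using hb
        by (intro integral_distr measurable_prob_measures[OF PiM_prob_measures[OF that X]]) auto
      have "\<bar>(\<integral>\<eta>. h (T \<eta>) \<partial>PiM {1..N} (\<lambda>_. P)) - (\<integral>\<eta>. h (T \<eta>) \<partial>PiM {1..N} (\<lambda>_. Q))\<bar>
          \<le> real (card {1..N}) * (c * d)"
      proof (rule product_integral_diff_le[OF P Q X])
        fix \<eta> i assume w: "\<eta> \<in> {1..N} \<rightarrow>\<^sub>E X" and i: "i \<in> {1..N}"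
        have "c-lipschitz_on X (\<lambda>x. h (T (\<eta>(i := x))))"
        proof (rule lipschitz_onI)
          fix x y assume xy: "x \<in> X" "y \<in> X"
          have "dist (h (T (\<eta>(i := x)))) (h (T (\<eta>(i := y)))) \<le> \<bar>T (\<eta>(i := x)) - T (\<eta>(i := y))\<bar>"
            using lipschitz_onD[OF h, of "T (\<eta>(i := x))" "T (\<eta>(i := y))"] by (simp add: dist_real_def)
          also have "\<dots> \<le> c * dist x y" by (rule T[OF w i xy])
          finally show "dist (h (T (\<eta>(i := x)))) (h (T (\<eta>(i := y)))) \<le> c * dist x y" .
        qed (use c in simp)
        from integral_diff_le_kantorovich[OF P Q X c this, of Y]
        show "\<bar>(\<integral>x. h (T (\<eta>(i := x))) \<partial>P) - (\<integral>x. h (T (\<eta>(i := x))) \<partial>Q)\<bar> \<le> c * d"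
          by (simp add: real)
      qed simp
      then show ?thesis unfolding law[OF P] law[OF Q] by (simp add: mult.assoc)
    qed
    then show ?thesis unfolding real kantorovich_def[of UNIV] by (intro SUP_least) auto
  qed
qed

section \<open>Normal quantiles\<close>

text \<open>The substitution of \<open>-y\<close> for \<open>y\<close> preserves the density, so
  \<open>{..x}\<close> and \<open>{-x..}\<close> have equal mass; for negative \<open>x\<close> they
  are disjoint.\<close>

lemma std_normal_cdf_neg_le_half:
  assumes "x < 0"
  shows "cdf std_normal_distribution x \<le> 1 / 2"
proof -
  interpret real_distribution std_normal_distribution by (rule real_dist_normal_dist)
  have "emeasure std_normal_distribution {..x} =
      (\<integral>\<^sup>+ y. ennreal (std_normal_density y) * indicator {..x} y \<partial>lborel)"
    by (simp add: emeasure_density)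
  also have "\<dots> = (\<integral>\<^sup>+ y. ennreal (std_normal_density y) * indicator {-x..} y \<partial>lborel)"
    by (subst nn_integral_real_affine[of _ "-1" 0])
       (auto simp: std_normal_density_def indicator_def intro!: nn_integral_cong)
  also have "\<dots> = emeasure std_normal_distribution {-x..}"
    by (simp add: emeasure_density)
  finally have "prob {..x} = prob {-x..}" by (simp add: measure_def)
  moreover have "prob {..x} + prob {-x..} = prob ({..x} \<union> {-x..})"
    using assms by (intro finite_measure_Union[symmetric]) auto
  ultimately have "2 * prob {..x} \<le> 1" using prob_le_1[of "{..x} \<union> {-x..}"] by linarith
  then show ?thesis by (simp add: cdf_def)
qed

text \<open>Makes the radii \<open>r_hat\<close> nonnegative. The bound \<open>u < 1\<close> ensures
  that the infimum is taken over a nonempty set.\<close>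

lemma std_normal_quantile_nonneg:
  assumes "1 / 2 < u" "u < 1"
  shows "0 \<le> quantile std_normal_distribution u"
  unfolding quantile_def
proof (rule cInf_greatest)
  interpret real_distribution std_normal_distribution by (rule real_dist_normal_dist)
  have "eventually (\<lambda>x. u < cdf std_normal_distribution x) at_top"
    using cdf_lim_at_top_prob assms(2) by (rule order_tendstoD)
  then show "{x. u \<le> cdf std_normal_distribution x} \<noteq> {}"
    by (auto simp: eventually_at_top_linorder intro: less_imp_le)
  fix x assume "x \<in> {x. u \<le> cdf std_normal_distribution x}"
  then show "0 \<le> x" using std_normal_cdf_neg_le_half[of x] assms(1) by (cases "x < 0") auto
qed

section \<open>Perturbation of ambiguity sets\<close>

text \<open>The point \<open>c\<close> slides along a segment towards \<open>l\<close> if its mass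
  is too large and towards \<open>u\<close> if it is too small. All coordinates move in the same
  direction, so the \<open>l1\<close> distance covered is exactly the mass defect.\<close>

lemma sum_one_between:
  fixes l u c :: "'i \<Rightarrow> real"
  assumes lu: "\<And>i. i \<in> I \<Longrightarrow> l i \<le> c i" "\<And>i. i \<in> I \<Longrightarrow> c i \<le> u i"
    and "sum l I \<le> 1" "1 \<le> sum u I"
  obtains q where "\<And>i. i \<in> I \<Longrightarrow> l i \<le> q i" "\<And>i. i \<in> I \<Longrightarrow> q i \<le> u i" "sum q I = 1"
    "(\<Sum>i\<in>I. \<bar>c i - q i\<bar>) = \<bar>sum c I - 1\<bar>"
proof (cases "1 \<le> sum c I")
  case True
  \<comment> \<open>If the denominator vanishes, then \<open>sum c I = 1\<close>, and division by
    zero yields the right value \<open>t = 0\<close>.\<close>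
  define t where "t = (sum c I - 1) / (sum c I - sum l I)"
  have t: "0 \<le> t" "t \<le> 1" "t * (sum c I - sum l I) = sum c I - 1"
    using True assms(3) by (auto simp: t_def divide_simps)
  show ?thesis
  proof (rule that[of "\<lambda>i. c i - t * (c i - l i)"])
    fix i assume i: "i \<in> I"
    have "0 \<le> t * (c i - l i)" "t * (c i - l i) \<le> 1 * (c i - l i)"
      using t lu[OF i] by (auto intro: mult_left_le_one_le)
    then show "l i \<le> c i - t * (c i - l i)" "c i - t * (c i - l i) \<le> u i"
      using lu(2)[OF i] by simp_all
  next
    show "(\<Sum>i\<in>I. c i - t * (c i - l i)) = 1"
      using t(3) by (simp add: sum_subtractf sum_distrib_left[symmetric])
    have "(\<Sum>i\<in>I. \<bar>c i - (c i - t * (c i - l i))\<bar>) = (\<Sum>i\<in>I. t * (c i - l i))"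
      using t lu by (intro sum.cong) auto
    then show "(\<Sum>i\<in>I. \<bar>c i - (c i - t * (c i - l i))\<bar>) = \<bar>sum c I - 1\<bar>"
      using t(3) True by (simp add: sum_subtractf sum_distrib_left[symmetric])
  qed
next
  case False
  define t where "t = (1 - sum c I) / (sum u I - sum c I)"
  have t: "0 \<le> t" "t \<le> 1" "t * (sum u I - sum c I) = 1 - sum c I"
    using False assms(4) by (auto simp: t_def divide_simps)
  show ?thesis
  proof (rule that[of "\<lambda>i. c i + t * (u i - c i)"])
    fix i assume i: "i \<in> I"
    have "0 \<le> t * (u i - c i)" "t * (u i - c i) \<le> 1 * (u i - c i)"
      using t lu[OF i] by (auto intro: mult_left_le_one_le)
    then show "l i \<le> c i + t * (u i - c i)" "c i + t * (u i - c i) \<le> u i"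
      using lu(1)[OF i] by simp_all
  next
    show "(\<Sum>i\<in>I. c i + t * (u i - c i)) = 1"
      using t(3) by (simp add: sum.distrib sum_subtractf sum_distrib_left[symmetric])
    have "(\<Sum>i\<in>I. \<bar>c i - (c i + t * (u i - c i))\<bar>) = (\<Sum>i\<in>I. t * (u i - c i))"
      using t lu by (intro sum.cong) auto
    then show "(\<Sum>i\<in>I. \<bar>c i - (c i + t * (u i - c i))\<bar>) = \<bar>sum c I - 1\<bar>"
      using t(3) False by (simp add: sum_subtractf sum_distrib_left[symmetric])
  qed
qed

text \<open>Clip \<open>q\<close> to the new box, then restore total mass one by moving towards a corner of the box.\<close>

lemma simplex_box_perturb:
  fixes p r p' r' q :: "'i \<Rightarrow> real"
  assumes r': "\<And>i. i \<in> I \<Longrightarrow> 0 \<le> r' i"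
    and p': "\<And>i. i \<in> I \<Longrightarrow> 0 \<le> p' i" "sum p' I = 1"
    and q: "\<And>i. i \<in> I \<Longrightarrow> 0 \<le> q i" "sum q I = 1"
    and qpr: "\<And>i. i \<in> I \<Longrightarrow> p i - r i \<le> q i" "\<And>i. i \<in> I \<Longrightarrow> q i \<le> p i + r i"
  obtains q' where "\<And>i. i \<in> I \<Longrightarrow> 0 \<le> q' i" "sum q' I = 1"
    "\<And>i. i \<in> I \<Longrightarrow> p' i - r' i \<le> q' i" "\<And>i. i \<in> I \<Longrightarrow> q' i \<le> p' i + r' i"
    "(\<Sum>i\<in>I. \<bar>q i - q' i\<bar>) \<le> 2 * (\<Sum>i\<in>I. \<bar>p i - p' i\<bar> + \<bar>r i - r' i\<bar>)"
proof -
  \<comment> \<open>Nonnegativity is built into the lower corner. The centre \<open>p'\<close> has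
    mass one and lies in the box, so the two corners have mass at most one and at least one.\<close>
  define l where "l i = max 0 (p' i - r' i)" for i
  define u where "u i = p' i + r' i" for i
  define c where "c i = max (l i) (min (u i) (q i))" for i
  let ?e = "\<Sum>i\<in>I. \<bar>p i - p' i\<bar> + \<bar>r i - r' i\<bar>"
  have lp: "l i \<le> p' i" and pu: "p' i \<le> u i" if "i \<in> I" for i
    using p'(1)[OF that] r'[OF that] by (auto simp: l_def u_def)
  have lu: "sum l I \<le> 1" "1 \<le> sum u I"
    using sum_mono[of I l p'] sum_mono[of I p' u] lp pu p'(2) by auto
  have c: "l i \<le> c i" "c i \<le> u i" if "i \<in> I" for i
    using lp[OF that] pu[OF that] by (auto simp: c_def)
  obtain q' where q': "\<And>i. i \<in> I \<Longrightarrow> l i \<le> q' i" "\<And>i. i \<in> I \<Longrightarrow> q' i \<le> u i"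
    "sum q' I = 1" "(\<Sum>i\<in>I. \<bar>c i - q' i\<bar>) = \<bar>sum c I - 1\<bar>"
    using sum_one_between[of I l c u, OF c lu] by blast
  \<comment> \<open>\<open>q i\<close> lies in the old interval, whose ends move by at most
    \<open>?d\<close>; raising the lower end to zero does no harm because \<open>q i\<close> is
    nonnegative.\<close>
  have "\<bar>q i - c i\<bar> \<le> \<bar>p i - p' i\<bar> + \<bar>r i - r' i\<bar>" (is "_ \<le> ?d") if "i \<in> I" for i
  proof -
    have "q i - ?d \<le> u i" using qpr(2)[OF that] unfolding u_def by linarith
    moreover have "l i \<le> q i + ?d"
      using qpr(1)[OF that] q(1)[OF that] unfolding l_def by linarith
    ultimately show ?thesis
      using lp[OF that] pu[OF that] unfolding c_def by linarith
  qed
  then have qc: "(\<Sum>i\<in>I. \<bar>q i - c i\<bar>) \<le> ?e" by (rule sum_mono)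
  \<comment> \<open>Since \<open>q\<close> has mass one, the mass defect of \<open>c\<close> is at
    most the clipping error. Paying this error twice gives the factor 2.\<close>
  have "\<bar>sum c I - 1\<bar> = \<bar>\<Sum>i\<in>I. q i - c i\<bar>" by (simp add: sum_subtractf q(2))
  also have "\<dots> \<le> (\<Sum>i\<in>I. \<bar>q i - c i\<bar>)" by (rule sum_abs)
  finally have cq: "(\<Sum>i\<in>I. \<bar>c i - q' i\<bar>) \<le> ?e" using qc q'(4) by linarith
  have "(\<Sum>i\<in>I. \<bar>q i - q' i\<bar>) \<le> (\<Sum>i\<in>I. \<bar>q i - c i\<bar> + \<bar>c i - q' i\<bar>)"
    by (rule sum_mono) linarith
  also have "\<dots> \<le> 2 * ?e" using qc cq by (simp add: sum.distrib)
  finally have "(\<Sum>i\<in>I. \<bar>q i - q' i\<bar>) \<le> 2 * ?e" .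
  then show thesis
    using q'(1-3) by (intro that[of q']) (simp_all add: l_def u_def)
qed

section \<open>Probability vectors as measures, and ambiguity sets of measures\<close>

lemma prob_measures_of_vector:
  fixes q :: "nat \<Rightarrow> real"
  assumes inj: "inj_on \<xi> {1..J}"
    and q: "\<And>j. j \<in> {1..J} \<Longrightarrow> 0 \<le> q j" "(\<Sum>j=1..J. q j) = 1"
  obtains P where "P \<in> prob_measures (\<xi> ` {1..J})" "\<And>j. j \<in> {1..J} \<Longrightarrow> measure P {\<xi> j} = q j"
proof
  define f where "f x = ennreal (q (the_inv_into {1..J} \<xi> x))" for x
  have f: "f (\<xi> j) = ennreal (q j)" if "j \<in> {1..J}" for j
    using that inj by (simp add: f_def the_inv_into_f_f)
  have "(\<Sum>x\<in>\<xi> ` {1..J}. f x) = (\<Sum>j=1..J. ennreal (q j))"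
    using inj f by (simp add: sum.reindex)
  also have "\<dots> = 1" using q by (subst sum_ennreal) auto
  finally show "point_measure (\<xi> ` {1..J}) f \<in> prob_measures (\<xi> ` {1..J})"
    by (simp add: prob_measures_def prob_space_point_measure sets_point_measure)
  show "measure (point_measure (\<xi> ` {1..J}) f) {\<xi> j} = q j" if "j \<in> {1..J}" for j
    using that q f by (simp add: measure_def emeasure_point_measure_finite)
qed

lemma sum_measure_image:
  fixes \<xi> :: "nat \<Rightarrow> 'a"
  assumes "inj_on \<xi> {1..J}" "P \<in> prob_measures (\<xi> ` {1..J})"
  shows "(\<Sum>j=1..J. measure P {\<xi> j}) = 1"
  using sum_measure_prob_measures[OF assms(2)] by (simp add: sum.reindex[OF assms(1)] del: One_nat_def)

text \<open>Pairing \<open>l1\<close> with the sup norm turns the closeness of weight vectors into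
  closeness of expectations, with one \<open>Q'\<close> serving all \<open>f\<close>.\<close>

lemma ambiguity_set_perturb:
  assumes inj: "inj_on \<xi> {1..J}"
    and r': "\<And>j. j \<in> {1..J} \<Longrightarrow> 0 \<le> r' j"
    and p': "\<And>j. j \<in> {1..J} \<Longrightarrow> 0 \<le> p' j" "(\<Sum>j=1..J. p' j) = 1"
    and Q: "Q \<in> ambiguity_set J \<xi> p r"
  obtains Q' where "Q' \<in> ambiguity_set J \<xi> p' r'"
    "\<And>f F. (\<And>x. x \<in> \<xi> ` {1..J} \<Longrightarrow> \<bar>f x\<bar> \<le> F) \<Longrightarrow>
      \<bar>(\<integral>x. f x \<partial>Q) - (\<integral>x. f x \<partial>Q')\<bar> \<le> F * (2 * (\<Sum>j=1..J. \<bar>p j - p' j\<bar> + \<bar>r j - r' j\<bar>))"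
proof -
  let ?e = "2 * (\<Sum>j=1..J. \<bar>p j - p' j\<bar> + \<bar>r j - r' j\<bar>)"
  have QP: "Q \<in> prob_measures (\<xi> ` {1..J})" using Q by (simp add: ambiguity_set_def)
  obtain q' where q': "\<And>j. j \<in> {1..J} \<Longrightarrow> 0 \<le> q' j" "sum q' {1..J} = 1"
    "\<And>j. j \<in> {1..J} \<Longrightarrow> p' j - r' j \<le> q' j" "\<And>j. j \<in> {1..J} \<Longrightarrow> q' j \<le> p' j + r' j"
    "(\<Sum>j=1..J. \<bar>measure Q {\<xi> j} - q' j\<bar>) \<le> ?e"
    using Q sum_measure_image[OF inj QP]
    by (rule_tac simplex_box_perturb[OF r' p', where p = p and r = r and q = "\<lambda>j. measure Q {\<xi> j}"])
       (auto simp: ambiguity_set_def)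
  from prob_measures_of_vector[OF inj q'(1,2)] obtain Q'
    where Q': "Q' \<in> prob_measures (\<xi> ` {1..J})" "\<And>j. j \<in> {1..J} \<Longrightarrow> measure Q' {\<xi> j} = q' j" by blast
  show thesis
  proof
    show "Q' \<in> ambiguity_set J \<xi> p' r'" using q' Q' by (simp add: ambiguity_set_def)
    fix f :: "'a \<Rightarrow> real" and F assume f: "\<And>x. x \<in> \<xi> ` {1..J} \<Longrightarrow> \<bar>f x\<bar> \<le> F"
    \<comment> \<open>A support point exists because the weights sum to one; evaluating
      \<open>f\<close> there shows that \<open>F\<close> is nonnegative.\<close>
    have "{1..J} \<noteq> {}" using p'(2) by (metis sum.empty zero_neq_one)
    then obtain j where "j \<in> {1..J}" by blast
    then have "\<bar>f (\<xi> j)\<bar> \<le> F" by (intro f imageI)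
    then have F: "0 \<le> F" by linarith
    have int: "(\<integral>x. f x \<partial>R) = (\<Sum>j=1..J. f (\<xi> j) * measure R {\<xi> j})"
      if "R \<in> prob_measures (\<xi> ` {1..J})" for R
      unfolding integral_prob_measures[OF that finite_imageI[OF finite_atLeastAtMost]]
      by (simp only: sum.reindex[OF inj] o_def)
    have "(\<integral>x. f x \<partial>Q) - (\<integral>x. f x \<partial>Q') = (\<Sum>j=1..J. f (\<xi> j) * (measure Q {\<xi> j} - q' j))"
      unfolding int[OF QP] int[OF Q'(1)] sum_subtractf[symmetric]
      by (intro sum.cong) (simp_all add: Q'(2) right_diff_distrib)
    also have "\<bar>\<dots>\<bar> \<le> (\<Sum>j=1..J. F * \<bar>measure Q {\<xi> j} - q' j\<bar>)"
      by (rule order_trans[OF sum_abs sum_mono])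
         (unfold abs_mult, intro mult_right_mono f imageI, simp_all)
    also have "\<dots> \<le> F * ?e"
      unfolding sum_distrib_left[symmetric] by (intro mult_left_mono q'(5) F)
    finally show "\<bar>(\<integral>x. f x \<partial>Q) - (\<integral>x. f x \<partial>Q')\<bar> \<le> F * ?e" .
  qed
qed

lemma ambiguity_set_nonempty:
  assumes inj: "inj_on \<xi> {1..J}"
    and "\<And>j. j \<in> {1..J} \<Longrightarrow> 0 \<le> r j" "\<And>j. j \<in> {1..J} \<Longrightarrow> 0 \<le> p j" "(\<Sum>j=1..J. p j) = 1"
  shows "ambiguity_set J \<xi> p r \<noteq> {}"
proof -
  obtain P where "P \<in> prob_measures (\<xi> ` {1..J})" "\<And>j. j \<in> {1..J} \<Longrightarrow> measure P {\<xi> j} = p j"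
    using prob_measures_of_vector[OF inj assms(3,4)] by blast
  then have "P \<in> ambiguity_set J \<xi> p r" using assms(2) by (auto simp: ambiguity_set_def)
  then show ?thesis by blast
qed

section \<open>Contractions in the weighted norm\<close>

lemma wspace_iff:
  assumes w: "\<And>s. s \<in> S \<Longrightarrow> 1 \<le> (w s :: real)"
  shows "V \<in> wspace S w \<longleftrightarrow> V \<in> extensional S \<and> (\<exists>b\<ge>0. \<forall>s\<in>S. \<bar>V s\<bar> \<le> b * w s)"
proof -
  have pos: "0 < w s" if "s \<in> S" for s using w[OF that] by simp
  have "(\<exists>b\<ge>0. \<forall>s\<in>S. \<bar>V s\<bar> \<le> b * w s)" if fin: "wnorm S w V < \<infinity>"
  proof (cases "S = {}")
    case False
    have up: "ereal (\<bar>V s\<bar> / w s) \<le> wnorm S w V" if "s \<in> S" for s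
      unfolding wnorm_def by (rule SUP_upper[OF that])
    obtain s0 where s0: "s0 \<in> S" using False by auto
    have "0 \<le> ereal (\<bar>V s0\<bar> / w s0)" using pos[OF s0] by simp
    then have "0 \<le> wnorm S w V" using up[OF s0] by (rule order_trans)
    then obtain b where b: "wnorm S w V = ereal b" "0 \<le> b" using fin by (cases "wnorm S w V") auto
    have "\<bar>V s\<bar> \<le> b * w s" if "s \<in> S" for s
      using up[OF that] b pos[OF that] by (simp add: pos_divide_le_eq)
    then show ?thesis using b by blast
  qed auto
  moreover have "wnorm S w V < \<infinity>" if "\<forall>s\<in>S. \<bar>V s\<bar> \<le> b * w s" for b
  proof -
    have "wnorm S w V \<le> ereal b"
      unfolding wnorm_def using that pos by (intro SUP_least) (simp add: pos_divide_le_eq)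
    then show ?thesis by (rule le_less_trans) simp
  qed
  ultimately show ?thesis by (auto simp: wspace_def)
qed

text \<open>Banach's theorem with pointwise estimates relative to \<open>w\<close>, in quantitative
  form: a start with residual \<open>b\<close> lies within \<open>b / (1 - c)\<close> of the fixed
  point. With the zero function as \<open>V0\<close> this gives an a priori bound, with the fixed
  point of another operator it gives stability.\<close>

lemma weighted_contraction_fixed_point:
  fixes S :: "'s set" and w :: "'s \<Rightarrow> real" and F :: "('s \<Rightarrow> real) \<Rightarrow> 's \<Rightarrow> real"
  assumes w: "\<And>s. s \<in> S \<Longrightarrow> 1 \<le> w s" and c: "0 \<le> c" "c < 1"
    and F: "\<And>V. V \<in> wspace S w \<Longrightarrow> F V \<in> wspace S w"
    and contr: "\<And>V V' e s. V \<in> wspace S w \<Longrightarrow> V' \<in> wspace S w \<Longrightarrow> 0 \<le> e \<Longrightarrow>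
      (\<And>s. s \<in> S \<Longrightarrow> \<bar>V s - V' s\<bar> \<le> e * w s) \<Longrightarrow> s \<in> S \<Longrightarrow> \<bar>F V s - F V' s\<bar> \<le> c * e * w s"
    and V0: "V0 \<in> wspace S w" and b: "0 \<le> b" "\<And>s. s \<in> S \<Longrightarrow> \<bar>F V0 s - V0 s\<bar> \<le> b * w s"
  shows "\<exists>!V. V \<in> wspace S w \<and> F V = V"
    and "\<And>V s. V \<in> wspace S w \<Longrightarrow> F V = V \<Longrightarrow> s \<in> S \<Longrightarrow> \<bar>V s - V0 s\<bar> \<le> b / (1 - c) * w s"
proof -
  note ws = wspace_iff[of S w, OF w]
  have cpow: "(\<lambda>n. c ^ n * k) \<longlonglongrightarrow> 0" for k
    using tendsto_mult[OF LIMSEQ_realpow_zero[OF c] tendsto_const[of k]] by simp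
  define e where "e = b / (1 - c)"
  have e: "0 \<le> e" using b c by (simp add: e_def)
  have unique: "V = V'" if V: "V \<in> wspace S w" "F V = V" and V': "V' \<in> wspace S w" "F V' = V'" for V V'
  proof (rule extensionalityI)
    show "V \<in> extensional S" "V' \<in> extensional S" using V V' ws by auto
    fix s assume s: "s \<in> S"
    obtain k k' where k: "0 \<le> k" "\<And>s. s \<in> S \<Longrightarrow> \<bar>V s\<bar> \<le> k * w s"
      and k': "0 \<le> k'" "\<And>s. s \<in> S \<Longrightarrow> \<bar>V' s\<bar> \<le> k' * w s"
      using V(1) V'(1) ws by meson
    \<comment> \<open>Applying the contraction \<open>n\<close> times leaves both fixed points in
      place but shrinks the a priori distance \<open>k + k'\<close>.\<close>
    have "\<bar>V s - V' s\<bar> \<le> c ^ n * (k + k') * w s" if "s \<in> S" for n s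
      using that
    proof (induction n arbitrary: s)
      case 0
      show ?case using k(2)[OF 0] k'(2)[OF 0] by (simp add: distrib_right)
    next
      case (Suc n)
      show ?case
        using contr[OF V(1) V'(1) _ Suc.IH Suc.prems] c k(1) k'(1) by (simp add: V(2) V'(2) mult.assoc)
    qed
    then have "\<bar>V s - V' s\<bar> \<le> 0"
      using s cpow[of "(k + k') * w s"] by (intro LIMSEQ_le_const[of _ 0]) (auto simp: mult.assoc)
    then show "V s = V' s" by simp
  qed
  define X where "X n = (F ^^ n) V0" for n
  define d where "d s n = X (Suc n) s - X n s" for s n
  have X: "X n \<in> wspace S w" for n by (induction n) (auto simp: X_def V0 F)
  have d: "\<bar>d s n\<bar> \<le> c ^ n * b * w s" if "s \<in> S" for s n
    using that
  proof (induction n arbitrary: s)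
    case 0
    then show ?case using b(2) by (simp add: d_def X_def)
  next
    case (Suc n)
    have "\<bar>F (X (Suc n)) s - F (X n) s\<bar> \<le> c * (c ^ n * b) * w s"
      using Suc c b(1) by (intro contr X) (auto simp: d_def)
    then show ?case by (simp add: d_def X_def mult.assoc)
  qed
  have geo: "(\<lambda>i. c ^ (i + n) * b * w s) sums (c ^ n * e * w s)" for n s
  proof -
    have "(\<lambda>i. c ^ n * b * w s * c ^ i) sums (c ^ n * b * w s * (1 / (1 - c)))"
      using c by (intro sums_mult geometric_sums) simp
    moreover have "c ^ n * b * w s * c ^ i = c ^ (i + n) * b * w s" for i
      by (simp add: power_add)
    moreover have "c ^ n * b * w s * (1 / (1 - c)) = c ^ n * e * w s" by (simp add: e_def)
    ultimately show ?thesis by (simp only:)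
  qed
  have sd: "summable (d s)" if "s \<in> S" for s
  proof (rule summable_comparison_test')
    show "summable (\<lambda>i. c ^ (i + 0) * b * w s)" by (rule sums_summable[OF geo])
    show "norm (d s n) \<le> c ^ (n + 0) * b * w s" for n using d[OF that, of n] by simp
  qed
  \<comment> \<open>The limit of the iterates, written as a telescoping series that a geometric
    series dominates at each state.\<close>
  define V where "V = (\<lambda>s\<in>S. V0 s + suminf (d s))"
  have VX: "\<bar>V s - X n s\<bar> \<le> c ^ n * e * w s" if s: "s \<in> S" for s n
  proof -
    have "X n s = V0 s + (\<Sum>i<n. d s i)"
      unfolding d_def sum_lessThan_telescope[of "\<lambda>i. X i s"] by (simp add: X_def)
    then have "V s - X n s = (\<Sum>i. d s (i + n))"
      using s suminf_minus_initial_segment[OF sd[OF s], of n] by (simp add: V_def)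
    also have "\<bar>\<dots>\<bar> \<le> (\<Sum>i. c ^ (i + n) * b * w s)"
      unfolding real_norm_def[symmetric]
      by (rule norm_suminf_le) (use d[OF s] sums_summable[OF geo] in auto)
    also have "\<dots> = c ^ n * e * w s" using geo by (rule sums_unique[symmetric])
    finally show ?thesis .
  qed
  have V: "V \<in> wspace S w"
  proof -
    obtain k where k: "0 \<le> k" "\<And>s. s \<in> S \<Longrightarrow> \<bar>V0 s\<bar> \<le> k * w s"
      using V0 ws by meson
    have "\<bar>V s\<bar> \<le> (k + e) * w s" if "s \<in> S" for s
      using k(2)[OF that] VX[OF that, of 0] by (simp add: X_def distrib_right)
    moreover have "V \<in> extensional S" by (simp add: V_def)
    moreover have "0 \<le> k + e" using k(1) e by simp
    ultimately show ?thesis using ws[of V] by blast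
  qed
  have FV: "F V = V"
  proof (rule extensionalityI)
    show "F V \<in> extensional S" "V \<in> extensional S" using V F ws by auto
    fix s assume s: "s \<in> S"
    \<comment> \<open>Both \<open>F V\<close> and \<open>V\<close> are compared with
      \<open>F (X n) = X (Suc n)\<close>, at a cost of \<open>c ^ Suc n * e * w s\<close>
      each.\<close>
    have "\<bar>F V s - V s\<bar> \<le> c ^ n * (2 * c * e * w s)" for n
    proof -
      have "\<bar>F V s - F (X n) s\<bar> \<le> c * (c ^ n * e) * w s"
        using c e by (intro contr V X VX s) auto
      moreover have "\<bar>V s - F (X n) s\<bar> \<le> c ^ Suc n * e * w s"
        using VX[OF s, of "Suc n"] by (simp add: X_def)
      ultimately show ?thesis by (simp add: abs_le_iff algebra_simps)
    qed
    then have "\<bar>F V s - V s\<bar> \<le> 0"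
      using LIMSEQ_le_const[OF cpow[of "2 * c * e * w s"]] by blast
    then show "F V s = V s" by simp
  qed
  show "\<exists>!V. V \<in> wspace S w \<and> F V = V" using V FV unique by blast
  show "\<bar>V' s - V0 s\<bar> \<le> b / (1 - c) * w s" if "V' \<in> wspace S w" "F V' = V'" "s \<in> S" for V' s
    using VX[OF that(3), of 0] unique[OF that(1,2) V FV] by (simp add: X_def e_def)
qed

text \<open>It suffices to match each \<open>P\<close> with some \<open>P'\<close> for each
  \<open>a\<close>. The bounds \<open>B\<close> and \<open>B'\<close> keep the real-valued suprema
  and the infimum genuine.\<close>

lemma INF_SUP_le_INF_SUP_add:
  fixes f f' :: "'a \<Rightarrow> 'b \<Rightarrow> real"
  assumes A: "A \<noteq> {}" and Q: "Q \<noteq> {}"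
    and f: "\<And>a P. a \<in> A \<Longrightarrow> P \<in> Q \<Longrightarrow> \<bar>f a P\<bar> \<le> B"
    and f': "\<And>a P. a \<in> A \<Longrightarrow> P \<in> Q' \<Longrightarrow> \<bar>f' a P\<bar> \<le> B'"
    and le: "\<And>a P. a \<in> A \<Longrightarrow> P \<in> Q \<Longrightarrow> \<exists>P'\<in>Q'. f a P \<le> f' a P' + e"
  shows "(INF a\<in>A. SUP P\<in>Q. f a P) \<le> (INF a\<in>A. SUP P\<in>Q'. f' a P) + e"
proof -
  have bdd: "bdd_above (f a ` Q)" "bdd_above (f' a ` Q')" if "a \<in> A" for a
    using f[OF that] f'[OF that] by (auto intro!: bdd_aboveI2 simp: abs_le_iff)
  obtain P0 where P0: "P0 \<in> Q" using Q by auto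
  have low: "bdd_below ((\<lambda>a. SUP P\<in>Q. f a P) ` A)"
  proof (rule bdd_belowI2)
    fix a assume a: "a \<in> A"
    have "- B \<le> f a P0" using f[OF a P0] by auto
    also have "\<dots> \<le> (SUP P\<in>Q. f a P)" by (rule cSUP_upper[OF P0 bdd(1)[OF a]])
    finally show "- B \<le> (SUP P\<in>Q. f a P)" .
  qed
  have "(INF a\<in>A. SUP P\<in>Q. f a P) - e \<le> (INF a\<in>A. SUP P\<in>Q'. f' a P)"
  proof (rule cINF_greatest[OF A])
    fix a assume a: "a \<in> A"
    have "(INF a\<in>A. SUP P\<in>Q. f a P) \<le> (SUP P\<in>Q. f a P)" by (rule cINF_lower[OF low a])
    also have "\<dots> \<le> (SUP P\<in>Q'. f' a P) + e"
    proof (rule cSUP_least[OF Q])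
      fix P assume "P \<in> Q"
      from le[OF a this] obtain P' where P': "P' \<in> Q'" "f a P \<le> f' a P' + e" by blast
      then show "f a P \<le> (SUP P\<in>Q'. f' a P) + e"
        using cSUP_upper[OF P'(1) bdd(2)[OF a]] by linarith
    qed
    finally show "(INF a\<in>A. SUP P\<in>Q. f a P) - e \<le> (SUP P\<in>Q'. f' a P)" by simp
  qed
  then show ?thesis by simp
qed

section \<open>Posterior estimates\<close>

text \<open>Multiplication by the conjugate; a lower bound on one of the two roots is
  enough.\<close>

lemma sqrt_diff_le:
  assumes "0 < m" "m \<le> sqrt a" "0 \<le> b"
  shows "\<bar>sqrt a - sqrt b\<bar> \<le> \<bar>a - b\<bar> / m"
proof -
  have a: "0 \<le> a" using assms by (metis less_eq_real_def not_le order_trans real_sqrt_ge_0_iff)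
  have "\<bar>sqrt a - sqrt b\<bar> * m \<le> \<bar>sqrt a - sqrt b\<bar> * (sqrt a + sqrt b)"
    using assms(2) real_sqrt_ge_zero[OF assms(3)] by (intro mult_left_mono) linarith+
  also have "\<dots> = \<bar>(sqrt a - sqrt b) * (sqrt a + sqrt b)\<bar>"
    using a assms(3) by (simp add: abs_mult)
  also have "(sqrt a - sqrt b) * (sqrt a + sqrt b) = a - b"
    using a assms(3) by (simp add: algebra_simps)
  finally show ?thesis using assms(1) by (simp add: pos_le_divide_eq)
qed

text \<open>In this setting \<open>p_hat\<close> is the mode of the Dirichlet posterior for
  multinomial counts; parameters above one keep the mode in the interior of the simplex when
  \<open>J\<close> is at least 2.\<close>

locale dirichlet_prior =
  fixes \<xi> :: "nat \<Rightarrow> 'a" and J :: nat and \<tau> :: "nat \<Rightarrow> real"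
  assumes inj: "inj_on \<xi> {1..J}" and J: "1 \<le> J" and tau: "\<And>j. j \<in> {1..J} \<Longrightarrow> 1 < \<tau> j"
begin

lemma posterior_total_eq: "posterior_total \<tau> J N = (\<Sum>j=1..J. \<tau> j - 1) + real N"
  by (simp add: posterior_total_def sum_subtractf)

lemma posterior_total_gt: "real N < posterior_total \<tau> J N"
  unfolding posterior_total_eq using J tau by (auto intro!: sum_pos)

lemma posterior_total_pos: "0 < posterior_total \<tau> J N"
  using posterior_total_gt[of N] by simp

lemma p_hat_ge: "j \<in> {1..J} \<Longrightarrow> (\<tau> j - 1) / posterior_total \<tau> J N \<le> p_hat \<tau> J \<xi> N \<eta> j"
  unfolding p_hat_def using posterior_total_pos by (intro divide_right_mono) (auto intro: sum_nonneg less_imp_le)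

lemma p_hat_pos: "j \<in> {1..J} \<Longrightarrow> 0 < p_hat \<tau> J \<xi> N \<eta> j"
  using p_hat_ge[of j N \<eta>] tau[of j] posterior_total_pos[of N]
  by (smt (verit) divide_pos_pos)

lemma sum_p_hat:
  assumes "\<eta> \<in> {1..N} \<rightarrow>\<^sub>E \<xi> ` {1..J}"
  shows "(\<Sum>j=1..J. p_hat \<tau> J \<xi> N \<eta> j) = 1"
proof -
  have 1: "(\<Sum>j=1..J. indicator {\<xi> j} (\<eta> i)) = (1::real)" if "i \<in> {1..N}" for i
  proof -
    have "\<eta> i \<in> \<xi> ` {1..J}" using assms that by (rule PiE_mem)
    then obtain k where k: "k \<in> {1..J}" "\<eta> i = \<xi> k" by blast
    have "indicator {\<xi> j} (\<eta> i) = (if j = k then 1 else 0 :: real)" if "j \<in> {1..J}" for j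
      unfolding k(2) using inj_on_eq_iff[OF inj that k(1)] by (auto simp: indicator_def)
    then have "(\<Sum>j=1..J. indicator {\<xi> j} (\<eta> i)) = (\<Sum>j\<in>{1..J}. if j = k then 1 else 0 :: real)"
      by (rule sum.cong[OF refl])
    then show ?thesis using k(1) by simp
  qed
  have "(\<Sum>j=1..J. \<Sum>i=1..N. indicator {\<xi> j} (\<eta> i)) = (\<Sum>i=1..N. \<Sum>j=1..J. indicator {\<xi> j} (\<eta> i) :: real)"
    by (rule sum.swap)
  also have "\<dots> = (\<Sum>i=1..N. 1)" by (intro sum.cong refl 1)
  finally have "(\<Sum>j=1..J. \<Sum>i=1..N. indicator {\<xi> j} (\<eta> i)) = real N" by simp
  then show ?thesis
    using posterior_total_pos[of N]
    by (simp add: p_hat_def sum_divide_distrib[symmetric] sum.distrib posterior_total_eq[symmetric] del: One_nat_def)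
qed

lemma p_hat_diff_le:
  assumes "i \<in> {1..N}"
  shows "\<bar>p_hat \<tau> J \<xi> N (\<eta>(i := x)) j - p_hat \<tau> J \<xi> N (\<eta>(i := y)) j\<bar> \<le> 1 / posterior_total \<tau> J N"
proof -
  have split: "(\<Sum>k=1..N. indicator {\<xi> j} ((\<eta>(i := z)) k)) =
      indicator {\<xi> j} z + (\<Sum>k\<in>{1..N} - {i}. indicator {\<xi> j} (\<eta> k) :: real)" for z
    by (subst sum.remove[OF _ assms]) (auto intro!: sum.cong)
  have "p_hat \<tau> J \<xi> N (\<eta>(i := x)) j - p_hat \<tau> J \<xi> N (\<eta>(i := y)) j =
      (indicator {\<xi> j} x - indicator {\<xi> j} y) / posterior_total \<tau> J N"
    unfolding p_hat_def split diff_divide_distrib[symmetric] by simp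
  also have "\<bar>\<dots>\<bar> \<le> 1 / posterior_total \<tau> J N"
    using posterior_total_pos[of N]
    by (auto simp: abs_divide indicator_def intro!: divide_right_mono)
  finally show ?thesis .
qed

lemma p_hat_le_1:
  assumes "\<eta> \<in> {1..N} \<rightarrow>\<^sub>E \<xi> ` {1..J}" "j \<in> {1..J}"
  shows "p_hat \<tau> J \<xi> N \<eta> j \<le> 1"
  unfolding sum_p_hat[OF assms(1), symmetric]
  by (rule member_le_sum[OF assms(2)]) (auto intro: less_imp_le[OF p_hat_pos])

text \<open>The smallest pseudo-count of the prior: whatever the sample, each posterior weight is at
  least this number divided by the posterior total.\<close>

definition prior_min :: real where "prior_min = Min ((\<lambda>j. \<tau> j - 1) ` {1..J})"

lemma prior_min_pos: "0 < prior_min"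
  unfolding prior_min_def using J tau by (subst Min_gr_iff) auto

lemma p_hat_ge_prior_min: "j \<in> {1..J} \<Longrightarrow> prior_min / posterior_total \<tau> J N \<le> p_hat \<tau> J \<xi> N \<eta> j"
  by (rule order_trans[OF divide_right_mono p_hat_ge])
     (auto simp: prior_min_def intro: less_imp_le[OF posterior_total_pos])

text \<open>A second support point exists, so \<open>1 - p\<close> is bounded below by its weight
  just as \<open>p\<close> is by its own. One of the two factors is at least \<open>1/2\<close>, the
  other at least \<open>?c\<close>.\<close>

lemma variance_p_hat_ge:
  assumes \<eta>: "\<eta> \<in> {1..N} \<rightarrow>\<^sub>E \<xi> ` {1..J}" and j: "j \<in> {1..J}" and J2: "2 \<le> J"
  defines "p \<equiv> p_hat \<tau> J \<xi> N \<eta> j"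
  shows "prior_min / (2 * posterior_total \<tau> J N) \<le> p * (1 - p)"
proof -
  let ?c = "prior_min / posterior_total \<tau> J N"
  obtain k where k: "k \<in> {1..J}" "k \<noteq> j"
    using J2 j by (metis atLeastAtMost_iff le_refl J nat_le_linear not_less_eq_eq numeral_2_eq_2 One_nat_def)
  have "(\<Sum>j\<in>{j, k}. p_hat \<tau> J \<xi> N \<eta> j) \<le> (\<Sum>j=1..J. p_hat \<tau> J \<xi> N \<eta> j)"
    using j k by (intro sum_mono2) (auto intro: less_imp_le[OF p_hat_pos])
  then have "p + p_hat \<tau> J \<xi> N \<eta> k \<le> 1" using k by (simp add: sum_p_hat[OF \<eta>] p_def del: One_nat_def)
  then have q: "?c \<le> 1 - p" using p_hat_ge_prior_min[OF k(1), of N \<eta>] by linarith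
  have p: "?c \<le> p" using p_hat_ge_prior_min[OF j] by (simp add: p_def)
  have c: "0 \<le> ?c" using prior_min_pos posterior_total_pos[of N] by simp
  show ?thesis
  proof (cases "p \<le> 1 / 2")
    case True
    have "?c * (1 / 2) \<le> p * (1 - p)" using p c True by (intro mult_mono) auto
    then show ?thesis by simp
  next
    case False
    have "(1 / 2) * ?c \<le> p * (1 - p)" using q c False by (intro mult_mono) auto
    then show ?thesis by simp
  qed
qed

text \<open>The lower bound on the variance compensates for the unbounded slope of the square root at
  zero. For \<open>J = 1\<close> the variance vanishes identically.\<close>

lemma r_hat_diff_le:
  assumes \<eta>: "\<eta> \<in> {1..N} \<rightarrow>\<^sub>E \<xi> ` {1..J}" and i: "i \<in> {1..N}" and j: "j \<in> {1..J}"
    and xy: "x \<in> \<xi> ` {1..J}" "y \<in> \<xi> ` {1..J}"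
    and z: "0 \<le> quantile std_normal_distribution (1 - (\<alpha> / real J) / 2)"
  shows "\<bar>r_hat \<alpha> \<tau> J \<xi> N (\<eta>(i := x)) j - r_hat \<alpha> \<tau> J \<xi> N (\<eta>(i := y)) j\<bar> \<le>
    quantile std_normal_distribution (1 - (\<alpha> / real J) / 2) / sqrt (prior_min / 2) / posterior_total \<tau> J N"
proof -
  define n where "n = posterior_total \<tau> J N"
  define z where "z = quantile std_normal_distribution (1 - (\<alpha> / real J) / 2)"
  define p where "p = p_hat \<tau> J \<xi> N (\<eta>(i := x)) j"
  define q where "q = p_hat \<tau> J \<xi> N (\<eta>(i := y)) j"
  have n: "0 < n" using posterior_total_pos by (simp add: n_def)
  have z0: "0 \<le> z" using z by (simp add: z_def)
  have upd: "\<eta>(i := u) \<in> {1..N} \<rightarrow>\<^sub>E \<xi> ` {1..J}" if "u \<in> \<xi> ` {1..J}" for u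
    using PiE_fun_upd[OF that \<eta>, of i] i by (simp add: insert_absorb)
  note ux = upd[OF xy(1)] and uy = upd[OF xy(2)]
  have p: "0 < p" "p \<le> 1" and q: "0 < q" "q \<le> 1"
    using p_hat_pos[OF j] p_hat_le_1[OF ux j] p_hat_le_1[OF uy j] by (auto simp: p_def q_def)
  have m: "0 < sqrt (prior_min / 2) / n" using prior_min_pos n by simp
  have "\<bar>sqrt (p * (1 - p) / n) - sqrt (q * (1 - q) / n)\<bar> \<le> 1 / sqrt (prior_min / 2) / n"
  proof (cases "J = 1")
    case True
    then have "p = 1" "q = 1"
      using sum_p_hat[OF ux] sum_p_hat[OF uy] j by (simp_all add: p_def q_def)
    then show ?thesis using prior_min_pos n by simp
  next
    case False
    have "prior_min / (2 * n) \<le> p * (1 - p)"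
      using variance_p_hat_ge[OF ux j] False J by (simp add: p_def n_def)
    \<comment> \<open>The further division by \<open>n\<close> puts the radicand above a multiple of
      \<open>1/n^2\<close>, hence the root above \<open>sqrt (prior_min / 2) / n\<close>.\<close>
    then have "prior_min / 2 / n\<^sup>2 \<le> p * (1 - p) / n"
      using n by (simp add: field_simps power2_eq_square)
    then have "sqrt (prior_min / 2 / n\<^sup>2) \<le> sqrt (p * (1 - p) / n)" by (rule real_sqrt_le_mono)
    then have "sqrt (prior_min / 2) / n \<le> sqrt (p * (1 - p) / n)"
      using n by (simp add: real_sqrt_divide real_sqrt_mult)
    then have "\<bar>sqrt (p * (1 - p) / n) - sqrt (q * (1 - q) / n)\<bar>
        \<le> \<bar>p * (1 - p) / n - q * (1 - q) / n\<bar> / (sqrt (prior_min / 2) / n)"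
      using q n by (intro sqrt_diff_le m) auto
    also have "\<dots> = \<bar>p - q\<bar> * \<bar>1 - p - q\<bar> / sqrt (prior_min / 2)"
    proof -
      \<comment> \<open>The factor \<open>1 - p - q\<close> is at most one in absolute value because
        \<open>p\<close> and \<open>q\<close> lie in the unit interval.\<close>
      have "p * (1 - p) - q * (1 - q) = (p - q) * (1 - p - q)" by algebra
      then have "p * (1 - p) / n - q * (1 - q) / n = (p - q) * (1 - p - q) / n"
        by (metis diff_divide_distrib)
      then show ?thesis using n by (simp add: abs_mult abs_divide)
    qed
    also have "\<dots> \<le> (1 / n) * 1 / sqrt (prior_min / 2)"
      using p_hat_diff_le[OF i, of \<eta> x j y] p q prior_min_pos n
      by (intro divide_right_mono mult_mono) (auto simp: p_def q_def n_def)
    finally show ?thesis by (simp add: mult.commute)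
  qed
  from mult_left_mono[OF this z0] show ?thesis
    using z0 by (simp add: r_hat_def p_def q_def n_def z_def abs_mult right_diff_distrib[symmetric])
qed

end

section \<open>Robust Bellman operators\<close>

text \<open>The ambiguity set is left as a parameter of the operator, so the fixed-point theory
  applies to any nonempty set of measures on \<open>X\<close>.\<close>

locale weighted_mdp =
  fixes S :: "'s set" and A :: "'a set" and X :: "'x set"
    and C :: "'s \<Rightarrow> 'a \<Rightarrow> 'x \<Rightarrow> real" and g :: "'s \<Rightarrow> 'a \<Rightarrow> 'x \<Rightarrow> 's"
    and \<gamma> :: real and w :: "'s \<Rightarrow> real" and K \<kappa> :: real
  assumes A: "A \<noteq> {}" and X: "finite X"
    and w: "\<And>s. s \<in> S \<Longrightarrow> 1 \<le> w s"
    and g: "\<And>s a x. s \<in> S \<Longrightarrow> a \<in> A \<Longrightarrow> x \<in> X \<Longrightarrow> g s a x \<in> S"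
    and K: "0 \<le> K" and \<gamma>: "0 \<le> \<gamma>" and \<kappa>: "0 \<le> \<kappa>" "\<gamma> * \<kappa> < 1"
    and C_growth: "\<And>s a x. s \<in> S \<Longrightarrow> a \<in> A \<Longrightarrow> x \<in> X \<Longrightarrow> \<bar>C s a x\<bar> \<le> K * w s"
    and g_growth: "\<And>s a x. s \<in> S \<Longrightarrow> a \<in> A \<Longrightarrow> x \<in> X \<Longrightarrow> w (g s a x) \<le> \<kappa> * w s"
begin

abbreviation bellman :: "'x measure set \<Rightarrow> ('s \<Rightarrow> real) \<Rightarrow> 's \<Rightarrow> real" where
  "bellman \<equiv> robust_bellman S A C g \<gamma>"

lemma wspace_iff': "V \<in> wspace S w \<longleftrightarrow> V \<in> extensional S \<and> (\<exists>b\<ge>0. \<forall>s\<in>S. \<bar>V s\<bar> \<le> b * w s)"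
  using w by (rule wspace_iff)

text \<open>The origin of the modulus \<open>\<gamma> * \<kappa>\<close>. Applied to a value
  function it controls growth, applied to a difference of two it gives the contraction.\<close>

lemma continuation_diff_le:
  assumes V: "\<And>s. s \<in> S \<Longrightarrow> \<bar>V s\<bar> \<le> e * w s" "0 \<le> e"
    and "s \<in> S" "a \<in> A" "x \<in> X"
  shows "\<bar>\<gamma> * V (g s a x)\<bar> \<le> \<gamma> * \<kappa> * e * w s"
proof -
  have "\<bar>V (g s a x)\<bar> \<le> e * w (g s a x)" by (intro V g assms)
  also have "\<dots> \<le> e * (\<kappa> * w s)" by (intro mult_left_mono g_growth assms)
  finally have "\<gamma> * \<bar>V (g s a x)\<bar> \<le> \<gamma> * (e * (\<kappa> * w s))" by (intro mult_left_mono \<gamma>)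
  then show ?thesis using \<gamma> by (simp add: abs_mult mult_ac)
qed

lemma stage_cost_le:
  assumes V: "\<And>s. s \<in> S \<Longrightarrow> \<bar>V s\<bar> \<le> b * w s" "0 \<le> b"
    and "s \<in> S" "a \<in> A" "x \<in> X"
  shows "\<bar>C s a x + \<gamma> * V (g s a x)\<bar> \<le> (K + \<gamma> * \<kappa> * b) * w s"
  using continuation_diff_le[of V b, OF assms] C_growth[OF assms(3-5)]
  by (simp add: distrib_right abs_le_iff)

text \<open>Treats a change of the value function (\<open>e\<close>) and of the set of measures
  (\<open>d\<close>) together: \<open>d = 0\<close> yields the contraction, \<open>e = 0\<close> the
  sensitivity to the ambiguity set.\<close>

lemma bellman_le:
  assumes V: "\<And>s. s \<in> S \<Longrightarrow> \<bar>V s\<bar> \<le> b * w s" "0 \<le> b" and V': "V' \<in> wspace S w"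
    and VV': "\<And>s. s \<in> S \<Longrightarrow> \<bar>V s - V' s\<bar> \<le> e * w s" "0 \<le> e"
    and Q: "Q \<noteq> {}" "Q \<subseteq> prob_measures X" and Q': "Q' \<subseteq> prob_measures X"
    and QQ': "\<And>P. P \<in> Q \<Longrightarrow> \<exists>P'\<in>Q'. \<forall>f B. (\<forall>x\<in>X. \<bar>f x\<bar> \<le> B) \<longrightarrow>
      \<bar>(\<integral>x. f x \<partial>P) - (\<integral>x. f x \<partial>P')\<bar> \<le> B * d"
    and s: "s \<in> S"
  shows "bellman Q V s \<le> bellman Q' V' s + ((K + \<gamma> * \<kappa> * b) * d + \<gamma> * \<kappa> * e) * w s"
proof -
  let ?f = "\<lambda>V a x. C s a x + \<gamma> * V (g s a x)"
  \<comment> \<open>\<open>b'\<close> only guarantees that the suprema over \<open>Q'\<close> are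
    genuine; it does not enter the estimate.\<close>
  obtain b' where b': "0 \<le> b'" "\<And>s. s \<in> S \<Longrightarrow> \<bar>V' s\<bar> \<le> b' * w s"
    using V' wspace_iff'[of V'] by blast
  have "(INF a\<in>A. SUP P\<in>Q. \<integral>x. ?f V a x \<partial>P) \<le> (INF a\<in>A. SUP P\<in>Q'. \<integral>x. ?f V' a x \<partial>P) +
      ((K + \<gamma> * \<kappa> * b) * d + \<gamma> * \<kappa> * e) * w s"
  proof (rule INF_SUP_le_INF_SUP_add[OF A Q(1)])
    fix a P assume a: "a \<in> A" and P: "P \<in> Q"
    then show "\<bar>\<integral>x. ?f V a x \<partial>P\<bar> \<le> (K + \<gamma> * \<kappa> * b) * w s"
      using Q(2) V s by (intro integral_prob_measures_abs_le[OF _ X] stage_cost_le) auto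
    obtain P' where P': "P' \<in> Q'" "\<And>f B. (\<forall>x\<in>X. \<bar>f x\<bar> \<le> B) \<Longrightarrow>
        \<bar>(\<integral>x. f x \<partial>P) - (\<integral>x. f x \<partial>P')\<bar> \<le> B * d"
      using QQ'[OF P] by blast
    \<comment> \<open>Triangle inequality through the integral of \<open>?f V a\<close> under
      \<open>P'\<close>: the measure changes first, then the value function.\<close>
    have "\<bar>(\<integral>x. ?f V a x \<partial>P) - (\<integral>x. ?f V a x \<partial>P')\<bar> \<le> (K + \<gamma> * \<kappa> * b) * w s * d"
      using V s a by (intro P'(2) ballI stage_cost_le)
    moreover have "\<bar>(\<integral>x. ?f V a x \<partial>P') - (\<integral>x. ?f V' a x \<partial>P')\<bar> \<le> \<gamma> * \<kappa> * e * w s"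
    proof -
      have PM: "P' \<in> prob_measures X" using P'(1) Q' by blast
      have "(\<integral>x. ?f V a x \<partial>P') - (\<integral>x. ?f V' a x \<partial>P') = (\<integral>x. ?f V a x - ?f V' a x \<partial>P')"
        by (rule Bochner_Integration.integral_diff[symmetric]) (rule integrable_prob_measures[OF PM X])+
      also have "\<bar>\<dots>\<bar> \<le> \<gamma> * \<kappa> * e * w s"
      proof (rule integral_prob_measures_abs_le[OF PM X])
        fix x assume "x \<in> X"
        from continuation_diff_le[of "\<lambda>s. V s - V' s" e, OF VV' s a this]
        show "\<bar>?f V a x - ?f V' a x\<bar> \<le> \<gamma> * \<kappa> * e * w s" by (simp add: right_diff_distrib)
      qed
      finally show ?thesis .
    qed
    ultimately have "(\<integral>x. ?f V a x \<partial>P) \<le> (\<integral>x. ?f V' a x \<partial>P') +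
        ((K + \<gamma> * \<kappa> * b) * d + \<gamma> * \<kappa> * e) * w s"
      by (simp add: abs_le_iff algebra_simps)
    then show "\<exists>P'\<in>Q'. (\<integral>x. ?f V a x \<partial>P) \<le> (\<integral>x. ?f V' a x \<partial>P') +
        ((K + \<gamma> * \<kappa> * b) * d + \<gamma> * \<kappa> * e) * w s"
      using P'(1) by blast
  next
    fix a P assume "a \<in> A" "P \<in> Q'"
    then show "\<bar>\<integral>x. ?f V' a x \<partial>P\<bar> \<le> (K + \<gamma> * \<kappa> * b') * w s"
      using Q' b' s by (intro integral_prob_measures_abs_le[OF _ X] stage_cost_le) auto
  qed
  then show ?thesis using s by (simp add: robust_bellman_def)
qed

text \<open>Comparison with the zero cost, whose inf-sup value is zero, in both directions.\<close>

lemma bellman_bound: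
  assumes V: "\<And>s. s \<in> S \<Longrightarrow> \<bar>V s\<bar> \<le> b * w s" "0 \<le> b"
    and Q: "Q \<noteq> {}" "Q \<subseteq> prob_measures X" and s: "s \<in> S"
  shows "\<bar>bellman Q V s\<bar> \<le> (K + \<gamma> * \<kappa> * b) * w s"
proof -
  let ?f = "\<lambda>a P. \<integral>x. C s a x + \<gamma> * V (g s a x) \<partial>P" and ?B = "(K + \<gamma> * \<kappa> * b) * w s"
  have f: "\<bar>?f a P\<bar> \<le> ?B" if "a \<in> A" "P \<in> Q" for a P
    using that Q(2) V s by (intro integral_prob_measures_abs_le[OF _ X] stage_cost_le) auto
  have B: "0 \<le> ?B" using f A Q(1) by (meson abs_ge_zero all_not_in_conv order_trans)
  have "(INF a\<in>A. SUP P\<in>Q. ?f a P) \<le> (INF a\<in>A. SUP P\<in>Q. 0) + ?B"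
    using f B Q(1) by (intro INF_SUP_le_INF_SUP_add[OF A Q(1), of _ ?B _ _ 0]) (auto simp: abs_le_iff)
  moreover have "(INF a\<in>A. SUP P\<in>Q. 0) \<le> (INF a\<in>A. SUP P\<in>Q. ?f a P) + ?B"
    using f B Q(1)
    by (intro INF_SUP_le_INF_SUP_add[OF A Q(1), of _ 0 _ _ ?B]) (fastforce simp: abs_le_iff)+
  ultimately show ?thesis using s A Q(1) by (simp add: robust_bellman_def abs_le_iff)
qed

lemma bellman_fixed_point:
  assumes Q: "Q \<noteq> {}" "Q \<subseteq> prob_measures X" and V0: "V0 \<in> wspace S w"
    and b: "0 \<le> b" "\<And>s. s \<in> S \<Longrightarrow> \<bar>bellman Q V0 s - V0 s\<bar> \<le> b * w s"
  shows "\<exists>!V. V \<in> wspace S w \<and> bellman Q V = V"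
    and "\<And>V s. V \<in> wspace S w \<Longrightarrow> bellman Q V = V \<Longrightarrow> s \<in> S \<Longrightarrow>
      \<bar>V s - V0 s\<bar> \<le> b / (1 - \<gamma> * \<kappa>) * w s"
proof -
  have closed: "bellman Q V \<in> wspace S w" if V: "V \<in> wspace S w" for V
  proof -
    obtain k where k: "0 \<le> k" "\<And>s. s \<in> S \<Longrightarrow> \<bar>V s\<bar> \<le> k * w s"
      using V wspace_iff'[of V] by blast
    have "bellman Q V \<in> extensional S" by (simp add: robust_bellman_def)
    moreover have "\<forall>s\<in>S. \<bar>bellman Q V s\<bar> \<le> (K + \<gamma> * \<kappa> * k) * w s"
      using bellman_bound[OF k(2,1) Q] by blast
    moreover have "0 \<le> K + \<gamma> * \<kappa> * k" using K \<gamma> \<kappa> k by simp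
    ultimately show ?thesis unfolding wspace_iff' by blast
  qed
  have le: "bellman Q V s \<le> bellman Q V' s + \<gamma> * \<kappa> * e * w s"
    if V: "V \<in> wspace S w" and V': "V' \<in> wspace S w" and e: "0 \<le> e"
      "\<And>s. s \<in> S \<Longrightarrow> \<bar>V s - V' s\<bar> \<le> e * w s" and s: "s \<in> S" for V V' e s
  proof -
    obtain k where k: "0 \<le> k" "\<And>s. s \<in> S \<Longrightarrow> \<bar>V s\<bar> \<le> k * w s"
      using V wspace_iff'[of V] by blast
    have "\<exists>P'\<in>Q. \<forall>f B. (\<forall>x\<in>X. \<bar>f x\<bar> \<le> B) \<longrightarrow> \<bar>(\<integral>x. f x \<partial>P) - (\<integral>x. f x \<partial>P')\<bar> \<le> B * (0::real)"
      if "P \<in> Q" for P using that by (auto intro!: bexI[of _ P])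
    from bellman_le[OF k(2,1) V' e(2,1) Q Q(2) this s] show ?thesis by simp
  qed
  have contr: "\<bar>bellman Q V s - bellman Q V' s\<bar> \<le> \<gamma> * \<kappa> * e * w s"
    if V: "V \<in> wspace S w" and V': "V' \<in> wspace S w" and e: "0 \<le> e"
      "\<And>s. s \<in> S \<Longrightarrow> \<bar>V s - V' s\<bar> \<le> e * w s" and s: "s \<in> S" for V V' e s
  proof -
    have "\<And>s. s \<in> S \<Longrightarrow> \<bar>V' s - V s\<bar> \<le> e * w s" using e(2) by (simp add: abs_minus_commute)
    from le[OF V V' e s] le[OF V' V e(1) this s] show ?thesis by linarith
  qed
  have c: "0 \<le> \<gamma> * \<kappa>" using \<gamma> \<kappa> by simp
  note fp = weighted_contraction_fixed_point[of S w "\<gamma> * \<kappa>" "bellman Q", OF w c \<kappa>(2) closed contr V0 b]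
  show "\<exists>!V. V \<in> wspace S w \<and> bellman Q V = V" by (rule fp(1))
  show "\<bar>V s - V0 s\<bar> \<le> b / (1 - \<gamma> * \<kappa>) * w s"
    if "V \<in> wspace S w" "bellman Q V = V" "s \<in> S" for V s by (rule fp(2)) (assumption | rule that)+
qed

text \<open>The iteration starts at zero, where the residual is at most \<open>K * w s\<close>; the
  resulting bound is the same for all sets \<open>Q\<close>.\<close>

lemma ex1_bellman_fixed_point:
  assumes Q: "Q \<noteq> {}" "Q \<subseteq> prob_measures X"
  shows "\<exists>!V. V \<in> wspace S w \<and> bellman Q V = V"
    and "\<And>V s. V \<in> wspace S w \<Longrightarrow> bellman Q V = V \<Longrightarrow> s \<in> S \<Longrightarrow> \<bar>V s\<bar> \<le> K / (1 - \<gamma> * \<kappa>) * w s"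
proof -
  define Z where "Z = (\<lambda>s\<in>S. 0 :: real)"
  have Z: "Z \<in> wspace S w" unfolding wspace_iff' Z_def by (auto intro!: exI[of _ 0])
  have b: "\<bar>bellman Q Z s - Z s\<bar> \<le> K * w s" if "s \<in> S" for s
    using bellman_bound[of Z 0 Q s] Q that by (simp add: Z_def)
  note fp = bellman_fixed_point[OF Q Z K b]
  show "\<exists>!V. V \<in> wspace S w \<and> bellman Q V = V" by (rule fp(1))
  show "\<bar>V s\<bar> \<le> K / (1 - \<gamma> * \<kappa>) * w s"
    if "V \<in> wspace S w" "bellman Q V = V" "s \<in> S" for V s
    using fp(2)[OF _ that] that(3) by (simp add: Z_def)
qed

text \<open>The fixed point \<open>V\<close> of one operator is taken as the starting point for the
  other. Its residual there comes only from the change of the set, so the quantitative fixed-point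
  bound applies.\<close>

lemma bellman_fixed_point_perturb:
  assumes Q: "Q \<noteq> {}" "Q \<subseteq> prob_measures X" and Q': "Q' \<noteq> {}" "Q' \<subseteq> prob_measures X"
    and QQ': "\<And>P. P \<in> Q \<Longrightarrow> \<exists>P'\<in>Q'. \<forall>f B. (\<forall>x\<in>X. \<bar>f x\<bar> \<le> B) \<longrightarrow>
      \<bar>(\<integral>x. f x \<partial>P) - (\<integral>x. f x \<partial>P')\<bar> \<le> B * d"
    and Q'Q: "\<And>P. P \<in> Q' \<Longrightarrow> \<exists>P'\<in>Q. \<forall>f B. (\<forall>x\<in>X. \<bar>f x\<bar> \<le> B) \<longrightarrow>
      \<bar>(\<integral>x. f x \<partial>P) - (\<integral>x. f x \<partial>P')\<bar> \<le> B * d"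
    and d: "0 \<le> d"
    and V: "V \<in> wspace S w" "bellman Q V = V" and V': "V' \<in> wspace S w" "bellman Q' V' = V'"
    and s: "s \<in> S"
  shows "\<bar>V s - V' s\<bar> \<le> K / (1 - \<gamma> * \<kappa>)\<^sup>2 * d * w s"
proof -
  let ?b = "K / (1 - \<gamma> * \<kappa>)"
  have b0: "0 \<le> ?b" using K \<kappa> by simp
  \<comment> \<open>The bound \<open>?b\<close> reproduces itself, so it also bounds the stage cost
    including the continuation value.\<close>
  have Kb: "K + \<gamma> * \<kappa> * ?b = ?b" using \<kappa> by (simp add: field_simps)
  have bV: "\<bar>V s\<bar> \<le> ?b * w s" if "s \<in> S" for s
    by (rule ex1_bellman_fixed_point(2)[OF Q V that])
  have "\<bar>bellman Q' V s - V s\<bar> \<le> ?b * d * w s" if s: "s \<in> S" for s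
  proof -
    have z: "\<bar>V s - V s\<bar> \<le> 0 * w s" for s by simp
    from bellman_le[OF bV b0 V(1) z order_refl Q Q'(2) QQ' s]
    have "V s \<le> bellman Q' V s + ?b * d * w s" unfolding Kb V(2) by simp
    moreover from bellman_le[OF bV b0 V(1) z order_refl Q' Q(2) Q'Q s]
    have "bellman Q' V s \<le> V s + ?b * d * w s" unfolding Kb V(2) by simp
    ultimately show ?thesis by (simp add: abs_le_iff)
  qed
  from bellman_fixed_point(2)[OF Q' V(1) mult_nonneg_nonneg[OF b0 d] this V' s]
  have "\<bar>V' s - V s\<bar> \<le> ?b * d / (1 - \<gamma> * \<kappa>) * w s" by simp
  also have "\<dots> = K / (1 - \<gamma> * \<kappa>)\<^sup>2 * d * w s" by (simp add: power2_eq_square)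
  finally show ?thesis by (simp add: abs_minus_commute)
qed

end

section \<open>Lipschitz dependence of the law of the value on the sampling distribution\<close>

theorem theorem7:
  fixes S :: "(real ^ 'm) set" and A :: "(real ^ 'n) set"
    and \<xi> :: "nat \<Rightarrow> real ^ 'k" and \<Xi> :: "(real ^ 'k) set" and J :: nat
    and C :: "real ^ 'm \<Rightarrow> real ^ 'n \<Rightarrow> real ^ 'k \<Rightarrow> real"
    and g :: "real ^ 'm \<Rightarrow> real ^ 'n \<Rightarrow> real ^ 'k \<Rightarrow> real ^ 'm"
    and w :: "real ^ 'm \<Rightarrow> real"
    and \<tau> :: "nat \<Rightarrow> real"
    and \<gamma> \<alpha> C_w \<kappa>_w L_C L_g L\<^sub>1 L\<^sub>2 :: real
  assumes S: "S \<noteq> {}" "closed S"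
    and A: "A \<noteq> {}" "closed A" "compact A"
    and Xi: "inj_on \<xi> {1..J}" "\<Xi> = \<xi> ` {1..J}"
    and g_maps: "\<And>s a x. s \<in> S \<Longrightarrow> a \<in> A \<Longrightarrow> x \<in> \<Xi> \<Longrightarrow> g s a x \<in> S"
    and gamma: "0 \<le> \<gamma>" "\<gamma> < 1"
    and tau: "\<And>j. j \<in> {1..J} \<Longrightarrow> 1 < \<tau> j"
    and alpha: "0 < \<alpha>" "\<alpha> < 1"
    and w: "continuous_on S w" "\<And>s. s \<in> S \<Longrightarrow> 1 \<le> w s"
    and C_cont: "\<And>x. x \<in> \<Xi> \<Longrightarrow> continuous_on (S \<times> A) (\<lambda>(s, a). C s a x)"
    and g_cont: "\<And>x. x \<in> \<Xi> \<Longrightarrow> continuous_on (S \<times> A) (\<lambda>(s, a). g s a x)"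
    and weights: "0 < C_w" "0 \<le> \<kappa>_w" "\<gamma> * \<kappa>_w < 1"
    and C_growth: "\<And>s a x. s \<in> S \<Longrightarrow> a \<in> A \<Longrightarrow> x \<in> \<Xi> \<Longrightarrow> \<bar>C s a x\<bar> \<le> C_w * w s"
    and g_growth: "\<And>s a x. s \<in> S \<Longrightarrow> a \<in> A \<Longrightarrow> x \<in> \<Xi> \<Longrightarrow> w (g s a x) \<le> \<kappa>_w * w s"
    and C_lip: "\<And>a x. a \<in> A \<Longrightarrow> x \<in> \<Xi> \<Longrightarrow> L_C-lipschitz_on S (\<lambda>s. C s a x)"
    and g_lip: "\<And>a x. a \<in> A \<Longrightarrow> x \<in> \<Xi> \<Longrightarrow> L_g-lipschitz_on S (\<lambda>s. g s a x)"
    and gamma_L_g: "\<gamma> * L_g < 1"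
    and L12: "0 < L\<^sub>1" "0 < L\<^sub>2"
    and C_lip_xi: "\<And>s x x'. s \<in> S \<Longrightarrow> x \<in> \<Xi> \<Longrightarrow> x' \<in> \<Xi> \<Longrightarrow>
                     (SUP a\<in>A. \<bar>C s a x - C s a x'\<bar>) \<le> L\<^sub>1 * norm (x - x')"
    and g_lip_xi: "\<And>s x x'. s \<in> S \<Longrightarrow> x \<in> \<Xi> \<Longrightarrow> x' \<in> \<Xi> \<Longrightarrow>
                     (SUP a\<in>A. norm (g s a x - g s a x')) \<le> L\<^sub>2 * norm (x - x')"
  shows "\<exists>L>0. \<forall>Pc\<in>prob_measures \<Xi>. \<forall>Pc'\<in>prob_measures \<Xi>. \<forall>N. \<forall>s\<in>S.
           kantorovich UNIV
             (sample_law N Pc (T_bar S A C g \<gamma> w \<alpha> \<tau> J \<xi> N s))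
             (sample_law N Pc' (T_bar S A C g \<gamma> w \<alpha> \<tau> J \<xi> N s))
           \<le> ereal L * kantorovich (convex hull \<Xi>) Pc Pc'"
proof (cases "J = 0")
  case True
  \<comment> \<open>An empty support carries no probability measure, so any positive
    \<open>L\<close> will do.\<close>
  then have "prob_measures \<Xi> = {}"
    using Xi(2) sum_measure_prob_measures[of _ "{} :: (real ^ 'k) set"] by auto
  then show ?thesis by (auto intro: exI[of _ 1])
next
  case False
  then have J: "1 \<le> J" by simp
  have X: "finite \<Xi>" by (simp add: Xi(2))
  interpret prior: dirichlet_prior \<xi> J \<tau>
    using Xi(1) J tau by unfold_locales
  interpret mdp: weighted_mdp S A \<Xi> C g \<gamma> w C_w \<kappa>_w
    using A(1) X w(2) g_maps weights gamma C_growth g_growth by unfold_locales auto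
  define z where "z = quantile std_normal_distribution (1 - (\<alpha> / real J) / 2)"
  \<comment> \<open>This places the quantile level strictly between \<open>1/2\<close> and
    1.\<close>
  have "\<alpha> / real J < 1" "0 < \<alpha> / real J" using alpha J by (simp_all add: divide_less_eq)
  then have z: "0 \<le> z" unfolding z_def
    by (intro std_normal_quantile_nonneg) argo+
  define R where "R = z / sqrt (prior.prior_min / 2)"
  have R: "0 \<le> R" using z prior.prior_min_pos by (simp add: R_def)
  define K where "K = C_w / (1 - \<gamma> * \<kappa>_w)\<^sup>2 * (2 * (real J * (1 + R)))"
  have K: "0 < K" using weights R J by (auto simp: K_def intro!: mult_pos_pos divide_pos_pos)
  let ?n = "posterior_total \<tau> J" and ?p = "p_hat \<tau> J \<xi>" and ?r = "r_hat \<alpha> \<tau> J \<xi>"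
  let ?amb = "\<lambda>N \<eta>. ambiguity_set J \<xi> (?p N \<eta>) (?r N \<eta>)"
  let ?T = "T_bar S A C g \<gamma> w \<alpha> \<tau> J \<xi>"
  have p: "0 \<le> ?p N \<eta> j" if "j \<in> {1..J}" for N \<eta> j
    by (rule less_imp_le[OF prior.p_hat_pos[OF that]])
  have r: "0 \<le> ?r N \<eta> j" if "\<eta> \<in> {1..N} \<rightarrow>\<^sub>E \<Xi>" "j \<in> {1..J}" for N \<eta> j
    using prior.p_hat_le_1[of \<eta> N j] that Xi(2) p[OF that(2), of N \<eta>] z
      less_imp_le[OF prior.posterior_total_pos[of N]]
    unfolding r_hat_def z_def[symmetric] by (intro mult_nonneg_nonneg real_sqrt_ge_zero divide_nonneg_nonneg) auto
  have nonempty: "?amb N \<eta> \<noteq> {}" if "\<eta> \<in> {1..N} \<rightarrow>\<^sub>E \<Xi>" for N \<eta>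
    using prior.sum_p_hat[of \<eta> N] that Xi(2) by (intro ambiguity_set_nonempty Xi(1) r p) auto
  have sub: "?amb N \<eta> \<subseteq> prob_measures \<Xi>" for N \<eta> by (auto simp: ambiguity_set_def Xi(2))
  have V_hat: "V_hat S A C g \<gamma> w \<alpha> \<tau> J \<xi> N \<eta> \<in> wspace S w"
      "mdp.bellman (?amb N \<eta>) (V_hat S A C g \<gamma> w \<alpha> \<tau> J \<xi> N \<eta>) = V_hat S A C g \<gamma> w \<alpha> \<tau> J \<xi> N \<eta>"
    if "\<eta> \<in> {1..N} \<rightarrow>\<^sub>E \<Xi>" for N \<eta>
    \<comment> \<open>Unique existence gives the definite description in \<open>V_hat\<close> its
      meaning for every sample from the support.\<close>
    using theI'[OF mdp.ex1_bellman_fixed_point(1)[OF nonempty[OF that] sub]]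
    unfolding V_hat_def[symmetric] by auto
  have T_diff: "\<bar>?T N s (\<eta>(i := x)) - ?T N s (\<eta>(i := y))\<bar> \<le> K / ?n N"
    if s: "s \<in> S" and \<eta>: "\<eta> \<in> {1..N} \<rightarrow>\<^sub>E \<Xi>" and i: "i \<in> {1..N}" and xy: "x \<in> \<Xi>" "y \<in> \<Xi>"
    for N s \<eta> i x y
  proof -
    let ?d = "2 * (real J * (1 + R)) / ?n N"
    have upd: "\<eta>(i := u) \<in> {1..N} \<rightarrow>\<^sub>E \<Xi>" if "u \<in> \<Xi>" for u
      using PiE_fun_upd[OF that \<eta>, of i] i by (simp add: insert_absorb)
    have close: "\<exists>P'\<in>?amb N (\<eta>(i := v)). \<forall>f B. (\<forall>x\<in>\<Xi>. \<bar>f x\<bar> \<le> B) \<longrightarrow>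
        \<bar>(\<integral>x. f x \<partial>P) - (\<integral>x. f x \<partial>P')\<bar> \<le> B * ?d"
      if u: "u \<in> \<Xi>" and v: "v \<in> \<Xi>" and P: "P \<in> ?amb N (\<eta>(i := u))" for u v P
    proof -
      let ?\<epsilon> = "\<Sum>j=1..J. \<bar>?p N (\<eta>(i := u)) j - ?p N (\<eta>(i := v)) j\<bar> + \<bar>?r N (\<eta>(i := u)) j - ?r N (\<eta>(i := v)) j\<bar>"
      have "?\<epsilon> \<le> (\<Sum>j=1..J. 1 / ?n N + R / ?n N)"
        using prior.p_hat_diff_le[OF i] prior.r_hat_diff_le[of \<eta> N i _ u v \<alpha>] \<eta> i u v z
        unfolding R_def z_def Xi(2) by (intro sum_mono add_mono) auto
      also have "\<dots> = real J * (1 + R) / ?n N" by (simp add: add_divide_distrib distrib_left)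
      finally have \<epsilon>: "2 * ?\<epsilon> \<le> ?d" by simp
      have sum: "(\<Sum>j=1..J. ?p N (\<eta>(i := v)) j) = 1"
        using upd[OF v] unfolding Xi(2) by (rule prior.sum_p_hat)
      obtain P' where P': "P' \<in> ?amb N (\<eta>(i := v))"
        "\<And>f B. (\<And>x. x \<in> \<xi> ` {1..J} \<Longrightarrow> \<bar>f x\<bar> \<le> B) \<Longrightarrow> \<bar>(\<integral>x. f x \<partial>P) - (\<integral>x. f x \<partial>P')\<bar> \<le> B * (2 * ?\<epsilon>)"
        using ambiguity_set_perturb[of \<xi> J "?r N (\<eta>(i := v))", OF Xi(1) r[OF upd[OF v]] p sum P] by blast
      have "\<bar>(\<integral>x. f x \<partial>P) - (\<integral>x. f x \<partial>P')\<bar> \<le> B * ?d" if f: "\<forall>x\<in>\<Xi>. \<bar>f x\<bar> \<le> B" for f B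
      proof -
        have "\<bar>f u\<bar> \<le> B" using f u by blast
        then have "0 \<le> B" by linarith
        with \<epsilon> have "B * (2 * ?\<epsilon>) \<le> B * ?d" by (rule mult_left_mono)
        moreover have "\<bar>(\<integral>x. f x \<partial>P) - (\<integral>x. f x \<partial>P')\<bar> \<le> B * (2 * ?\<epsilon>)"
          using f Xi(2) by (intro P'(2)) blast
        ultimately show ?thesis by linarith
      qed
      then show ?thesis using P'(1) by blast
    qed
    have d0: "0 \<le> ?d" using R less_imp_le[OF prior.posterior_total_pos[of N]] by simp
    have "\<bar>V_hat S A C g \<gamma> w \<alpha> \<tau> J \<xi> N (\<eta>(i := x)) s - V_hat S A C g \<gamma> w \<alpha> \<tau> J \<xi> N (\<eta>(i := y)) s\<bar>
        \<le> C_w / (1 - \<gamma> * \<kappa>_w)\<^sup>2 * ?d * w s"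
      by (rule mdp.bellman_fixed_point_perturb[OF nonempty[OF upd[OF xy(1)]] sub
            nonempty[OF upd[OF xy(2)]] sub close[OF xy] close[OF xy(2,1)] d0
            V_hat[OF upd[OF xy(1)]] V_hat[OF upd[OF xy(2)]] s])
    also have "C_w / (1 - \<gamma> * \<kappa>_w)\<^sup>2 * ?d * w s = K / ?n N * w s" by (simp add: K_def)
    finally show ?thesis
      using w(2)[OF s] by (simp add: T_bar_def diff_divide_distrib[symmetric] abs_divide pos_divide_le_eq)
  qed
  obtain \<delta> where \<delta>: "0 < \<delta>" "\<And>x y. x \<in> \<Xi> \<Longrightarrow> y \<in> \<Xi> \<Longrightarrow> x \<noteq> y \<Longrightarrow> \<delta> \<le> dist x y"
  proof
    \<comment> \<open>The extra element 1 keeps the set nonempty when there is only one support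
      point.\<close>
    let ?D = "insert 1 ((\<lambda>(x, y). dist x y) ` {(x, y) \<in> \<Xi> \<times> \<Xi>. x \<noteq> y})"
    have fin: "finite ?D" using X by (auto intro: finite_subset[of _ "\<Xi> \<times> \<Xi>"])
    show "0 < Min ?D" using fin by (subst Min_gr_iff) auto
    show "Min ?D \<le> dist x y" if "x \<in> \<Xi>" "y \<in> \<Xi>" "x \<noteq> y" for x y
      using fin that by (intro Min_le) force+
  qed
  show ?thesis
  proof (intro exI[of _ "K / \<delta>"] conjI ballI allI)
    show "0 < K / \<delta>" using K \<delta>(1) by simp
    fix Pc Pc' N s
    assume P: "Pc \<in> prob_measures \<Xi>" "Pc' \<in> prob_measures \<Xi>" and s: "s \<in> S"
    let ?c = "K / \<delta> / ?n N"
    have n: "0 < ?n N" by (rule prior.posterior_total_pos)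
    have "kantorovich UNIV (sample_law N Pc (?T N s)) (sample_law N Pc' (?T N s))
        \<le> ereal (real N * ?c) * kantorovich (convex hull \<Xi>) Pc Pc'"
    proof (rule kantorovich_sample_law_le[OF P X])
      show "0 < ?c" using K \<delta>(1) n by simp
      fix \<eta> i x y
      assume \<eta>: "\<eta> \<in> {1..N} \<rightarrow>\<^sub>E \<Xi>" and i: "i \<in> {1..N}" and xy: "x \<in> \<Xi>" "y \<in> \<Xi>"
      show "\<bar>?T N s (\<eta>(i := x)) - ?T N s (\<eta>(i := y))\<bar> \<le> ?c * dist x y"
      proof (cases "x = y")
        case False
        \<comment> \<open>The oscillation bound \<open>K / ?n N\<close> equals
          \<open>?c * \<delta>\<close>, and distinct points are at least \<open>\<delta>\<close>
          apart.\<close>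
        have "?c * \<delta> \<le> ?c * dist x y"
          using \<delta>(2)[OF xy False] K \<delta>(1) n by (intro mult_left_mono) auto
        then show ?thesis using T_diff[OF s \<eta> i xy] \<delta>(1) by simp
      qed simp
    qed
    also have "\<dots> \<le> ereal (K / \<delta>) * kantorovich (convex hull \<Xi>) Pc Pc'"
    proof (intro ereal_mult_right_mono kantorovich_nonneg)
      \<comment> \<open>The posterior total exceeds \<open>N\<close>, so the number of exchanged
        coordinates cancels and the constant depends neither on \<open>N\<close> nor on
        \<open>s\<close>.\<close>
      have "K / \<delta> * (real N / ?n N) \<le> K / \<delta> * 1"
        using prior.posterior_total_gt[of N] n K \<delta>(1) by (intro mult_left_mono) auto
      then show "ereal (real N * ?c) \<le> ereal (K / \<delta>)" by (simp add: mult_ac)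
    qed
    finally show "kantorovich UNIV (sample_law N Pc (?T N s)) (sample_law N Pc' (?T N s))
        \<le> ereal (K / \<delta>) * kantorovich (convex hull \<Xi>) Pc Pc'" .
  qed
qed

end
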